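(* Let $n=2k+1$ be an odd integer with $k\ge 1$, let $K$ be a field, let $X=(x_{ij})_{1\le i,j\le n}$ and $Y=(y_{ij})_{1\le i,j\le n}$ be matrices of independent indeterminates over $K$, let $R=K[X,Y]$ be the polynomial ring in all these $2n^2$ variables, and let $C=XY-YX=(c_{ij})$. Let $\mathcal{I}$ be the ideal of $R$ generated by all diagonal entries $c_{ii}$ and all anti-diagonal entries $c_{i,n+1-i}$ ($1\le i\le n$) of $C$. Let $$\Lambda=\{(i,j): 1\le i\le k,\ 1\le j\le 2k+1\}\cup\{(k+1,k+1)\}\cup\{(i,j): k+2\le i\le 2k+1,\ k+2\le j\le 2k+1\}\cup\{(i,j): k+3\le i\le 2k+1,\ 1\le j\le k\}.$$ Then the elements $$x_{ij},\ y_{ji}\quad\text{with }(i,j)\in\Lambda,$$ $$x_{k+1,s}-y_{2k+2-s,k+1}\quad\text{with }1\le s\le 2k+1,\ s\ne k+1,$$ $$x_{s,k+1}-y_{k+1,s}\quad\text{with }k+2\le s\le 2k+1,$$ $$x_{k+2,s}-y_{s,k+2}\quad\text{with }1\le s\le k$$ form a homogeneous system of parameters for $R/\mathcal{I}$.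
   Context: $R$ is graded by total degree with all variables of degree $1$. A homogeneous system of parameters for a quotient $R/\mathfrak a$ by a homogeneous ideal $\mathfrak a$ is a sequence of $\dim(R/\mathfrak a)$ homogeneous elements of positive degree such that the quotient of $R/\mathfrak a$ by the ideal they generate has Krull dimension $0$ (equivalently, together with $\mathfrak a$ they generate an ideal primary to the homogeneous maximal ideal of $R$). *)

theory Defs
  imports
    "HOL-Algebra.QuotRing"
    "HOL-Library.Poly_Mapping"
    "HOL-Library.Extended_Real"
begin

text \<open>A polynomial with variables of type \<open>'v\<close> maps finitely many monomials
  (exponent vectors \<open>'v \<Rightarrow>\<^sub>0 nat\<close>) to nonzero coefficients.\<close>

type_synonym ('v, 'a) mpoly = "('v \<Rightarrow>\<^sub>0 nat) \<Rightarrow>\<^sub>0 'a"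

definition mpoly_ring :: "'v set \<Rightarrow> ('v, 'a::comm_ring_1) mpoly ring" where
  "mpoly_ring V = \<lparr>carrier = {p. \<forall>m \<in> Poly_Mapping.keys p. Poly_Mapping.keys m \<subseteq> V},
     mult = (*), one = 1, zero = 0, add = (+)\<rparr>"

lemma mpoly_ring_simps [simp]:
  "p \<in> carrier (mpoly_ring V) \<longleftrightarrow>
     (\<forall>m \<in> Poly_Mapping.keys p. Poly_Mapping.keys m \<subseteq> V)"
  "p \<otimes>\<^bsub>mpoly_ring V\<^esub> q = p * q"
  "\<one>\<^bsub>mpoly_ring V\<^esub> = 1"
  "\<zero>\<^bsub>mpoly_ring V\<^esub> = 0"
  "p \<oplus>\<^bsub>mpoly_ring V\<^esub> q = p + q"
  by (simp_all add: mpoly_ring_def)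

lemma cring_mpoly_ring: "cring (mpoly_ring V)"
proof (intro cringI abelian_groupI comm_monoidI)
  fix p q :: "('a, 'b) mpoly"
  assume p: "p \<in> carrier (mpoly_ring V)" and q: "q \<in> carrier (mpoly_ring V)"
  show "p \<oplus>\<^bsub>mpoly_ring V\<^esub> q \<in> carrier (mpoly_ring V)"
    using p q Poly_Mapping.keys_add[of p q] by (simp; blast)
  show "p \<otimes>\<^bsub>mpoly_ring V\<^esub> q \<in> carrier (mpoly_ring V)"
  proof (unfold mpoly_ring_simps, intro ballI)
    fix m assume "m \<in> Poly_Mapping.keys (p * q)"
    then obtain a b where "m = a + b" "a \<in> Poly_Mapping.keys p" "b \<in> Poly_Mapping.keys q"
      using Poly_Mapping.keys_mult[of p q] by blast
    then show "Poly_Mapping.keys m \<subseteq> V"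
      using p q Poly_Mapping.keys_add[of a b] by (simp; blast)
  qed
next
  fix p :: "('a, 'b) mpoly"
  assume "p \<in> carrier (mpoly_ring V)"
  then show "\<exists>q\<in>carrier (mpoly_ring V). q \<oplus>\<^bsub>mpoly_ring V\<^esub> p = \<zero>\<^bsub>mpoly_ring V\<^esub>"
    by (intro bexI[of _ "- p"]) simp_all
qed (auto simp: algebra_simps)

definition mvar :: "'v \<Rightarrow> ('v, 'a::comm_ring_1) mpoly" where
  "mvar v = Poly_Mapping.single (Poly_Mapping.single v 1) 1"

definition mdeg :: "('v \<Rightarrow>\<^sub>0 nat) \<Rightarrow> nat" where
  "mdeg m = (\<Sum>v \<in> Poly_Mapping.keys m. Poly_Mapping.lookup m v)"

text \<open>The zero polynomial is homogeneous of every degree.\<close>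

definition homogeneous :: "nat \<Rightarrow> ('v, 'a::comm_ring_1) mpoly \<Rightarrow> bool" where
  "homogeneous d p \<longleftrightarrow> (\<forall>m \<in> Poly_Mapping.keys p. mdeg m = d)"

definition homogeneous_ideal :: "'v set \<Rightarrow> ('v, 'a::comm_ring_1) mpoly set \<Rightarrow> bool" where
  "homogeneous_ideal V \<aa> \<longleftrightarrow>
     (\<exists>S \<subseteq> carrier (mpoly_ring V). (\<forall>f \<in> S. \<exists>d. homogeneous d f) \<and>
        \<aa> = genideal (mpoly_ring V) S)"

text \<open>The supremum of the lengths of strict chains of prime ideals
  \<open>P 0 \<subset> \<dots> \<subset> P l\<close>. A ring without prime ideals (the zero ring) has dimension
  \<open>- \<infinity>\<close>.\<close>

definition krull_dim :: "('r, 'm) ring_scheme \<Rightarrow> ereal" where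
  "krull_dim A =
     (SUP l \<in> {l. \<exists>P. (\<forall>i\<le>l. primeideal (P i) A) \<and> (\<forall>i<l. P i \<subset> P (Suc i))}.
        ereal (real l))"

text \<open>The sequence \<open>qs\<close> consists of elements of \<open>K[V]/\<aa>\<close>, that is, of cosets; its
  homogeneous elements of degree \<open>d\<close> are the classes of homogeneous polynomials of degree
  \<open>d\<close>.\<close>

definition hsop ::
    "'v set \<Rightarrow> ('v, 'a::field) mpoly set \<Rightarrow> ('v, 'a) mpoly set list \<Rightarrow> bool" where
  "hsop V \<aa> qs \<longleftrightarrow>
     homogeneous_ideal V \<aa> \<and>
     ereal (real (length qs)) = krull_dim (mpoly_ring V Quot \<aa>) \<and>
     (\<forall>q \<in> set qs. \<exists>d>0. \<exists>f \<in> carrier (mpoly_ring V).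
        homogeneous d f \<and> q = \<aa> +>\<^bsub>mpoly_ring V\<^esub> f) \<and>
     krull_dim ((mpoly_ring V Quot \<aa>) Quot (genideal (mpoly_ring V Quot \<aa>) (set qs))) = 0"

datatype var = X nat nat | Y nat nat

definition mat_vars :: "nat \<Rightarrow> var set" where
  "mat_vars n = {X i j | i j. i \<in> {1..n} \<and> j \<in> {1..n}} \<union>
                {Y i j | i j. i \<in> {1..n} \<and> j \<in> {1..n}}"

abbreviation xvar :: "nat \<Rightarrow> nat \<Rightarrow> (var, 'a::comm_ring_1) mpoly" where
  "xvar i j \<equiv> mvar (X i j)"

abbreviation yvar :: "nat \<Rightarrow> nat \<Rightarrow> (var, 'a::comm_ring_1) mpoly" where
  "yvar i j \<equiv> mvar (Y i j)"

text \<open>The \<open>(i, j)\<close> entry of \<open>XY - YX\<close>.\<close>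

definition comm_entry :: "nat \<Rightarrow> nat \<Rightarrow> nat \<Rightarrow> (var, 'a::comm_ring_1) mpoly" where
  "comm_entry n i j = (\<Sum>l\<in>{1..n}. xvar i l * yvar l j) - (\<Sum>l\<in>{1..n}. yvar i l * xvar l j)"

definition diag_antidiag_ideal :: "nat \<Rightarrow> (var, 'a::comm_ring_1) mpoly set" where
  "diag_antidiag_ideal n =
     genideal (mpoly_ring (mat_vars n))
       ({comm_entry n i i | i. i \<in> {1..n}} \<union> {comm_entry n i (n + 1 - i) | i. i \<in> {1..n}})"

definition Lambda :: "nat \<Rightarrow> (nat \<times> nat) set" where
  "Lambda k =
     {(i, j). 1 \<le> i \<and> i \<le> k \<and> 1 \<le> j \<and> j \<le> 2 * k + 1} \<union>
     {(k + 1, k + 1)} \<union>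
     {(i, j). k + 2 \<le> i \<and> i \<le> 2 * k + 1 \<and> k + 2 \<le> j \<and> j \<le> 2 * k + 1} \<union>
     {(i, j). k + 3 \<le> i \<and> i \<le> 2 * k + 1 \<and> 1 \<le> j \<and> j \<le> k}"

text \<open>A list, so that every listed element counts towards the length of the system.\<close>

definition parameters :: "nat \<Rightarrow> (var, 'a::comm_ring_1) mpoly list" where
  "parameters k =
     [xvar i j. i \<leftarrow> [1..<2 * k + 2], j \<leftarrow> [1..<2 * k + 2], (i, j) \<in> Lambda k] @
     [yvar j i. i \<leftarrow> [1..<2 * k + 2], j \<leftarrow> [1..<2 * k + 2], (i, j) \<in> Lambda k] @
     [xvar (k + 1) s - yvar (2 * k + 2 - s) (k + 1). s \<leftarrow> [1..<2 * k + 2], s \<noteq> k + 1] @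
     [xvar s (k + 1) - yvar (k + 1) s. s \<leftarrow> [k + 2..<2 * k + 2]] @
     [xvar (k + 2) s - yvar s (k + 2). s \<leftarrow> [1..<k + 1]]"

end

theory Submission
  imports Defs "HOL-Library.Nat_Bijection"
begin

text \<open>
  Let \<open>\<theta>\<close> be the given list of \<open>8k\<^sup>2 + 4k + 2\<close> linear forms, \<open>R\<close> the polynomial ring and \<open>I\<close> the ideal
  of the diagonal and anti-diagonal entries of \<open>C = XY - YX\<close>. Three facts give the theorem.

  First, every variable is nilpotent modulo \<open>I + (\<theta>)\<close> (lemma \<open>variables_in_radical\<close>). Setting the
  parameters to zero leaves only the variables \<open>x\<close> in row \<open>k + 1\<close> outside the centre, in column
  \<open>k + 1\<close> below the centre, and at the first \<open>k\<close> places of row \<open>k + 2\<close>. Outside the centre, the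
  anti-diagonal entries of \<open>C\<close> become, up to sign, the squares of the variables of row \<open>k + 1\<close>;
  modulo these, the diagonal entries become, up to sign, squares of the other variables or, for the
  entry at \<open>k + 2\<close>, a sum of such squares in which all but one are already known to be nilpotent.
  Hence only one prime ideal of \<open>R\<close> contains \<open>I + (\<theta>)\<close>, and the quotient has dimension zero.

  Secondly, \<open>dim R/I \<le> length \<theta>\<close>. By the first fact and homogeneity, the polynomials of
  degree at most \<open>s\<close> are spanned modulo \<open>I\<close> by \<open>O(s ^ length \<theta>)\<close> products of parameters with
  finitely many monomials. Hence any \<open>length \<theta> + 1\<close> polynomials satisfy a polynomial relation
  modulo \<open>I\<close>, whereas the elements \<open>x\<^sub>i \<in> P\<^sub>i\<^sub>+\<^sub>1 - P\<^sub>i\<close> picked from a chain of primes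
  above \<open>I\<close> satisfy none (lemma \<open>prime_chain_power_products_independent\<close>).

  Thirdly, \<open>dim R/I \<ge> 2n\<^sup>2 - (2n - 2) = length \<theta>\<close> (lemma \<open>krull_dim_linear_ge\<close>). The trace of
  \<open>C\<close> vanishes, so \<open>2n - 2\<close> of the entries generate \<open>I\<close>, and each is a linear form in the variables
  \<open>y\<close> with coefficients in \<open>K[X]\<close>. Solving this linear system over \<open>K[X]\<close> parametrises part of
  the zero set of \<open>I\<close> by an affine space of dimension at least \<open>n\<^sup>2 + (n\<^sup>2 - (2n - 2))\<close>, and
  setting the coordinates of this space to zero one after the other gives a chain of primes
  of that length.
\<close>

section \<open>Polynomial rings and substitution\<close>

abbreviation polys :: "'v set \<Rightarrow> ('v, 'a::comm_ring_1) mpoly set" where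
  "polys V \<equiv> carrier (mpoly_ring V)"

declare mpoly_ring_simps(1) [simp del]

lemma polys_iff: "p \<in> polys V \<longleftrightarrow> (\<forall>m\<in>Poly_Mapping.keys p. Poly_Mapping.keys m \<subseteq> V)"
  by (rule mpoly_ring_simps(1))

lemma polys_zero [simp]: "0 \<in> polys V"
  and polys_one [simp]: "1 \<in> polys V"
  by (simp_all add: polys_iff)

lemma polys_add [simp]: "p \<in> polys V \<Longrightarrow> q \<in> polys V \<Longrightarrow> p + q \<in> polys V"
  using cring.cring_simprules(1)[OF cring_mpoly_ring, of p V q] by simp

lemma polys_mult [simp]: "p \<in> polys V \<Longrightarrow> q \<in> polys V \<Longrightarrow> p * q \<in> polys V"
  using cring.cring_simprules(5)[OF cring_mpoly_ring, of p V q] by simp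

lemma polys_uminus [simp]: "p \<in> polys V \<Longrightarrow> - p \<in> polys V"
  by (simp add: polys_iff)

lemma polys_diff [simp]: "p \<in> polys V \<Longrightarrow> q \<in> polys V \<Longrightarrow> p - q \<in> polys V"
  using polys_add[of p V "- q"] by simp

lemma polys_sum: "(\<And>i. i \<in> S \<Longrightarrow> f i \<in> polys V) \<Longrightarrow> sum f S \<in> polys V"
  by (induction S rule: infinite_finite_induct) auto

lemma polys_prod: "(\<And>i. i \<in> S \<Longrightarrow> f i \<in> polys V) \<Longrightarrow> prod f S \<in> polys V"
  by (induction S rule: infinite_finite_induct) auto

lemma polys_power [simp]: "p \<in> polys V \<Longrightarrow> p ^ n \<in> polys V"
  by (induction n) auto

lemma polys_mono: "V \<subseteq> W \<Longrightarrow> p \<in> polys V \<Longrightarrow> p \<in> polys W"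
  by (auto simp: polys_iff)

lemma polys_single: "Poly_Mapping.keys m \<subseteq> V \<Longrightarrow> Poly_Mapping.single m c \<in> polys V"
  by (simp add: polys_iff)

lemma polys_mvar [simp]: "v \<in> V \<Longrightarrow> mvar v \<in> polys V"
  by (simp add: mvar_def polys_single)

lemma sum_single_lookup:
  fixes p :: "('v, 'a::comm_ring_1) mpoly"
  assumes "finite S" "Poly_Mapping.keys p \<subseteq> S"
  shows "p = (\<Sum>m\<in>S. Poly_Mapping.single m (Poly_Mapping.lookup p m))"
proof (rule poly_mapping_eqI)
  fix k
  have "(\<Sum>m\<in>S. Poly_Mapping.lookup (Poly_Mapping.single m (Poly_Mapping.lookup p m)) k)
      = (\<Sum>m\<in>S. if m = k then Poly_Mapping.lookup p k else 0)"
    by (intro sum.cong) (auto simp: lookup_single when_def)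
  also have "\<dots> = Poly_Mapping.lookup p k"
    using assms by (auto simp: in_keys_iff subset_iff)
  finally show "Poly_Mapping.lookup p k
      = Poly_Mapping.lookup (\<Sum>m\<in>S. Poly_Mapping.single m (Poly_Mapping.lookup p m)) k"
    by (simp add: lookup_sum)
qed

lemma mpoly_induct [case_names zero single add]:
  fixes p :: "('v, 'a::comm_ring_1) mpoly"
  assumes "P 0"
    and "\<And>m c. m \<in> Poly_Mapping.keys p \<Longrightarrow> P (Poly_Mapping.single m c)"
    and "\<And>p q. P p \<Longrightarrow> P q \<Longrightarrow> P (p + q)"
  shows "P p"
proof -
  have "P (\<Sum>m\<in>S. Poly_Mapping.single m (Poly_Mapping.lookup p m))"
    if "finite S" "S \<subseteq> Poly_Mapping.keys p" for S
    using that by (induction S rule: finite_induct) (auto intro: assms)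
  from this[of "Poly_Mapping.keys p"] show ?thesis
    using sum_single_lookup[of "Poly_Mapping.keys p" p] by simp
qed

definition monom_subst :: "('v \<Rightarrow> 'r::comm_ring_1) \<Rightarrow> ('v \<Rightarrow>\<^sub>0 nat) \<Rightarrow> 'r" where
  "monom_subst \<sigma> m = (\<Prod>v\<in>Poly_Mapping.keys m. \<sigma> v ^ Poly_Mapping.lookup m v)"

text \<open>The homomorphism of algebras over the coefficient ring that sends \<open>mvar v\<close> to \<open>\<sigma> v\<close>.\<close>

definition subst :: "('v \<Rightarrow> ('w, 'a) mpoly) \<Rightarrow> ('v, 'a::comm_ring_1) mpoly \<Rightarrow> ('w, 'a) mpoly" where
  "subst \<sigma> p = (\<Sum>m\<in>Poly_Mapping.keys p.
     Poly_Mapping.single 0 (Poly_Mapping.lookup p m) * monom_subst \<sigma> m)"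

lemma monom_subst_superset:
  assumes "finite S" "Poly_Mapping.keys m \<subseteq> S"
  shows "monom_subst \<sigma> m = (\<Prod>v\<in>S. \<sigma> v ^ Poly_Mapping.lookup m v)"
  unfolding monom_subst_def
  by (rule prod.mono_neutral_left) (use assms in \<open>auto simp: in_keys_iff\<close>)

lemma monom_subst_zero [simp]: "monom_subst \<sigma> 0 = 1"
  by (simp add: monom_subst_def)

lemma monom_subst_add: "monom_subst \<sigma> (m + m') = monom_subst \<sigma> m * monom_subst \<sigma> m'"
proof -
  let ?S = "Poly_Mapping.keys m \<union> Poly_Mapping.keys m'"
  have "monom_subst \<sigma> (m + m') = (\<Prod>v\<in>?S. \<sigma> v ^ Poly_Mapping.lookup (m + m') v)"
    using Poly_Mapping.keys_add[of m m'] by (intro monom_subst_superset) auto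
  also have "\<dots> = monom_subst \<sigma> m * monom_subst \<sigma> m'"
    by (simp add: monom_subst_superset[of ?S] lookup_add power_add prod.distrib)
  finally show ?thesis .
qed

lemma subst_superset:
  assumes "finite S" "Poly_Mapping.keys p \<subseteq> S"
  shows "subst \<sigma> p = (\<Sum>m\<in>S. Poly_Mapping.single 0 (Poly_Mapping.lookup p m) * monom_subst \<sigma> m)"
  unfolding subst_def
  by (rule sum.mono_neutral_left) (use assms in \<open>auto simp: in_keys_iff\<close>)

lemma subst_add [simp]: "subst \<sigma> (p + q) = subst \<sigma> p + subst \<sigma> q"
proof -
  let ?S = "Poly_Mapping.keys p \<union> Poly_Mapping.keys q"
  have "subst \<sigma> (p + q)
      = (\<Sum>m\<in>?S. Poly_Mapping.single 0 (Poly_Mapping.lookup (p + q) m) * monom_subst \<sigma> m)"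
    using Poly_Mapping.keys_add[of p q] by (intro subst_superset) auto
  then show ?thesis
    by (simp add: subst_superset[of ?S] lookup_add single_add distrib_right sum.distrib)
qed

lemma subst_zero [simp]: "subst \<sigma> 0 = 0"
  by (simp add: subst_def)

lemma subst_single: "subst \<sigma> (Poly_Mapping.single m c) = Poly_Mapping.single 0 c * monom_subst \<sigma> m"
  by (cases "c = 0") (simp_all add: subst_def)

lemma subst_one [simp]: "subst \<sigma> 1 = 1"
  using subst_single[of \<sigma> 0 1] by simp

lemma single_zero_mult:
  "Poly_Mapping.single 0 (c * c') = Poly_Mapping.single 0 c * Poly_Mapping.single (0 :: 'v::comm_monoid_add) (c' :: 'a::comm_ring_1)"
  by (simp add: mult_single)

lemma subst_mult [simp]: "subst \<sigma> (p * q) = subst \<sigma> p * subst \<sigma> q"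
proof (induction p rule: mpoly_induct)
  case (single m c)
  show ?case
  proof (induction q rule: mpoly_induct)
    case (single m' c')
    show ?case
      by (simp add: mult_single subst_single monom_subst_add) (simp add: single_zero_mult mult_ac)
  qed (auto simp: distrib_left)
qed (auto simp: distrib_right)

lemma subst_uminus [simp]: "subst \<sigma> (- p) = - subst \<sigma> p"
  using subst_add[of \<sigma> p "- p"] by (simp add: eq_neg_iff_add_eq_0 add.commute del: subst_add)

lemma subst_diff [simp]: "subst \<sigma> (p - q) = subst \<sigma> p - subst \<sigma> q"
  using subst_add[of \<sigma> p "- q"] by simp

lemma subst_sum: "subst \<sigma> (sum f S) = (\<Sum>i\<in>S. subst \<sigma> (f i))"
  by (induction S rule: infinite_finite_induct) auto

lemma subst_prod: "subst \<sigma> (prod f S) = (\<Prod>i\<in>S. subst \<sigma> (f i))"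
  by (induction S rule: infinite_finite_induct) auto

lemma subst_power: "subst \<sigma> (p ^ n) = subst \<sigma> p ^ n"
  by (induction n) auto

lemma subst_mvar [simp]: "subst \<sigma> (mvar v) = \<sigma> v"
  by (simp add: mvar_def subst_single monom_subst_def)

lemma subst_subst: "subst \<tau> (subst \<sigma> p) = subst (\<lambda>v. subst \<tau> (\<sigma> v)) p"
proof (induction p rule: mpoly_induct)
  case (single m c)
  have "subst \<tau> (Poly_Mapping.single 0 c) = Poly_Mapping.single 0 c"
    by (simp add: subst_single)
  then show ?case
    by (simp add: subst_single[of _ m] monom_subst_def subst_prod subst_power)
qed auto

lemma mvar_power: "mvar v ^ n = Poly_Mapping.single (Poly_Mapping.single v n) 1"
  by (induction n) (simp_all add: mvar_def mult_single flip: single_add)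

lemma monom_subst_mvar: "monom_subst mvar m = Poly_Mapping.single m 1"
proof -
  have "(\<Prod>v\<in>S. mvar v ^ f v)
      = (Poly_Mapping.single (\<Sum>v\<in>S. Poly_Mapping.single v (f v)) 1 :: ('a, 'b) mpoly)"
    if "finite S" for S and f :: "'a \<Rightarrow> nat"
    using that by (induction S rule: finite_induct) (simp_all add: mvar_power mult_single)
  moreover have "(\<Sum>v\<in>Poly_Mapping.keys m. Poly_Mapping.single v (Poly_Mapping.lookup m v)) = m"
    by (rule poly_mapping_eqI)
       (auto simp: lookup_sum lookup_single when_def in_keys_iff sum.delta'[OF finite_keys])
  ultimately show ?thesis
    by (simp add: monom_subst_def)
qed

lemma subst_cong:
  assumes "p \<in> polys V" "\<And>v. v \<in> V \<Longrightarrow> \<sigma> v = \<tau> v"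
  shows "subst \<sigma> p = subst \<tau> p"
  unfolding subst_def monom_subst_def
  by (intro sum.cong arg_cong2[where f = "(*)"] prod.cong arg_cong2[where f = "(^)"] refl assms(2))
     (use assms(1) in \<open>auto simp: polys_iff\<close>)

lemma subst_mvar_id: "subst mvar p = p"
  by (induction p rule: mpoly_induct) (simp_all add: subst_single monom_subst_mvar mult_single)

lemma subst_eq_self:
  assumes "p \<in> polys V" "\<And>v. v \<in> V \<Longrightarrow> \<sigma> v = mvar v"
  shows "subst \<sigma> p = p"
  using subst_cong[of p V \<sigma> mvar] assms subst_mvar_id by auto

section \<open>Ideals of polynomial rings and chains of primes\<close>

lemma mpoly_ideal_iff:
  "ideal J (mpoly_ring V) \<longleftrightarrow> J \<subseteq> polys V \<and> 0 \<in> J \<and> (\<forall>p\<in>J. \<forall>q\<in>J. p + q \<in> J) \<and>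
     (\<forall>p\<in>J. \<forall>r\<in>polys V. r * p \<in> J)" (is "?L \<longleftrightarrow> ?R")
proof
  assume ?L
  then interpret ideal J "mpoly_ring V" .
  show ?R
  proof (intro conjI ballI)
    show "J \<subseteq> polys V" by (rule a_subset)
    show "0 \<in> J"
      using additive_subgroup.zero_closed[OF ideal.axioms(1)[OF is_ideal]] by simp
    show "p + q \<in> J" if "p \<in> J" "q \<in> J" for p q
      using additive_subgroup.a_closed[OF ideal.axioms(1)[OF is_ideal] that] by simp
    show "r * p \<in> J" if "p \<in> J" "r \<in> polys V" for p r
      using I_l_closed[OF that] by simp
  qed
next
  assume R: ?R
  interpret cring "mpoly_ring V" by (rule cring_mpoly_ring)
  have neg: "\<ominus>\<^bsub>mpoly_ring V\<^esub> p = - p" if "p \<in> polys V" for p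
    by (rule minus_equality) (use that in auto)
  have "- p \<in> J" if "p \<in> J" for p
    using R that by (metis mult_minus1 polys_one polys_uminus)
  then have inv: "inv\<^bsub>add_monoid (mpoly_ring V)\<^esub> p \<in> J" if "p \<in> J" for p
    using neg[of p] R that unfolding a_inv_def by auto
  show ?L
  proof (intro idealI ring_axioms subgroup.intro inv)
    fix a x :: "('a, 'b) mpoly" assume "a \<in> J" "x \<in> polys V"
    then show "x \<otimes>\<^bsub>mpoly_ring V\<^esub> a \<in> J" "a \<otimes>\<^bsub>mpoly_ring V\<^esub> x \<in> J"
      using R by (simp_all add: mult.commute)
  qed (use R in auto)
qed

lemmas mpoly_idealD = mpoly_ideal_iff[THEN iffD1]

lemma mpoly_ideal_mult: "ideal J (mpoly_ring V) \<Longrightarrow> p \<in> J \<Longrightarrow> r \<in> polys V \<Longrightarrow> r * p \<in> J"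
  and mpoly_ideal_add: "ideal J (mpoly_ring V) \<Longrightarrow> p \<in> J \<Longrightarrow> q \<in> J \<Longrightarrow> p + q \<in> J"
  and mpoly_ideal_polys: "ideal J (mpoly_ring V) \<Longrightarrow> p \<in> J \<Longrightarrow> p \<in> polys V"
  using mpoly_idealD by blast+

lemma mpoly_ideal_sum:
  assumes "ideal J (mpoly_ring V)" "\<And>i. i \<in> S \<Longrightarrow> f i \<in> J"
  shows "sum f S \<in> J"
  using assms(2) mpoly_idealD[OF assms(1)]
  by (induction S rule: infinite_finite_induct) auto

lemma mpoly_ideal_diff:
  assumes "ideal J (mpoly_ring V)" "p \<in> J" "q \<in> J"
  shows "p - q \<in> J"
proof -
  have "- 1 * q \<in> J"
    using mpoly_idealD[OF assms(1)] assms(3) by (metis polys_one polys_uminus)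
  then have "p + (- 1 * q) \<in> J"
    using mpoly_idealD[OF assms(1)] assms(2) by blast
  then show ?thesis by simp
qed

lemma mpoly_prime_iff:
  "primeideal P (mpoly_ring V) \<longleftrightarrow> ideal P (mpoly_ring V) \<and> 1 \<notin> P \<and>
     (\<forall>p\<in>polys V. \<forall>q\<in>polys V. p * q \<in> P \<longrightarrow> p \<in> P \<or> q \<in> P)" (is "?L \<longleftrightarrow> ?R")
proof
  assume ?L
  then interpret primeideal P "mpoly_ring V" .
  show ?R
    using is_ideal I_prime one_imp_carrier I_notcarr by auto
next
  assume R: ?R
  have "polys V \<noteq> P"
    using R polys_one by metis
  with R show ?L
    by (intro primeidealI cring_mpoly_ring) auto
qed

lemma ideal_genideal_mpoly: "S \<subseteq> polys V \<Longrightarrow> ideal (genideal (mpoly_ring V) S) (mpoly_ring V)"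
  by (rule ring.genideal_ideal[OF cring.axioms(1)[OF cring_mpoly_ring]])

lemma genideal_mpoly_superset: "S \<subseteq> polys V \<Longrightarrow> S \<subseteq> genideal (mpoly_ring V) S"
  by (rule ring.genideal_self[OF cring.axioms(1)[OF cring_mpoly_ring]])

lemma genideal_mpoly_minimal:
  "ideal J (mpoly_ring V) \<Longrightarrow> S \<subseteq> J \<Longrightarrow> genideal (mpoly_ring V) S \<subseteq> J"
  by (rule ring.genideal_minimal[OF cring.axioms(1)[OF cring_mpoly_ring]])

definition prime_chain :: "('r, 'm) ring_scheme \<Rightarrow> nat \<Rightarrow> (nat \<Rightarrow> 'r set) \<Rightarrow> bool" where
  "prime_chain R l P \<longleftrightarrow> (\<forall>i\<le>l. primeideal (P i) R) \<and> (\<forall>i<l. P i \<subset> P (Suc i))"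

lemma krull_dim_prime_chain:
  "krull_dim R = (SUP l \<in> {l. \<exists>P. prime_chain R l P}. ereal (real l))"
  by (simp add: krull_dim_def prime_chain_def)

lemma prime_chain_mono:
  assumes "prime_chain R l P" "i \<le> j" "j \<le> l"
  shows "P i \<subseteq> P j"
  using assms(2,3)
proof (induction j rule: dec_induct)
  case (step j)
  then have "P j \<subset> P (Suc j)"
    using assms(1) by (simp add: prime_chain_def)
  with step show ?case
    by auto
qed auto

lemma prime_chain_vimage:
  assumes "ring_hom_ring R S h" "cring R" "h ` carrier R = carrier S" "prime_chain S l P"
  shows "prime_chain R l (\<lambda>i. {r \<in> carrier R. h r \<in> P i})"
proof -
  interpret ring_hom_ring R S h by fact
  have "\<exists>r\<in>carrier R. h r \<notin> P i \<and> h r \<in> P (Suc i)" if "i < l" for i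
  proof -
    from that assms(4) have "P i \<subset> P (Suc i)"
      by (simp add: prime_chain_def)
    then obtain x where x: "x \<in> P (Suc i)" "x \<notin> P i"
      by blast
    have "ideal (P (Suc i)) S"
      using that assms(4) by (auto simp: prime_chain_def primeideal_def)
    then have "x \<in> carrier S"
      using x(1) by (rule ideal.Icarr)
    then obtain r where "r \<in> carrier R" "h r = x"
      unfolding assms(3)[symmetric] by blast
    then show ?thesis
      using x by blast
  qed
  moreover have "P i \<subseteq> P (Suc i)" if "i < l" for i
    using that assms(4) by (auto simp: prime_chain_def)
  moreover have "primeideal {r \<in> carrier R. h r \<in> P i} R" if "i \<le> l" for i
    using that assms(2,4) primeideal_vimage by (auto simp: prime_chain_def)
  ultimately show ?thesis
    by (simp add: prime_chain_def) blast
qed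

lemma carrier_quot: "carrier (R Quot A) = (+>\<^bsub>R\<^esub>) A ` carrier R"
  unfolding FactRing_def partial_object.simps A_RCOSETS_def' by blast

lemma rcos_mem_image_iff:
  fixes R (structure)
  assumes "ring R" "ideal A R" "ideal P R" "A \<subseteq> P" "a \<in> carrier R"
  shows "A +> a \<in> (+>) A ` P \<longleftrightarrow> a \<in> P"
proof
  interpret ring R by fact
  interpret P: ideal P R by fact
  assume "A +> a \<in> (+>) A ` P"
  then obtain p where p: "p \<in> P" "A +> a = A +> p"
    by blast
  have "\<zero> \<oplus> a \<in> A +> a"
    using additive_subgroup.zero_closed[OF ideal.axioms(1)[OF assms(2)]] a_r_coset_def'[of R A a]
    by blast
  then have "a \<in> A +> p"
    using assms(5) p(2) by simp
  then obtain x where "x \<in> A" "a = x \<oplus> p"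
    using a_r_coset_def'[of R A p] by blast
  then show "a \<in> P"
    using p(1) assms(4) by auto
qed blast

lemma primeideal_quot_image:
  fixes R (structure)
  assumes "cring R" "ideal A R" "primeideal P R" "A \<subseteq> P"
  shows "primeideal ((+>) A ` P) (R Quot A)"
proof -
  interpret cring R by fact
  interpret P: primeideal P R by fact
  interpret h: ring_hom_ring R "R Quot A" "(+>) A"
    by (rule ideal.rcos_ring_hom_ring[OF assms(2)])
  note carr = carrier_quot[of R A]
  note mem = rcos_mem_image_iff[OF ring_axioms assms(2) P.is_ideal assms(4)]
  show ?thesis
  proof (rule primeidealI)
    show "ideal ((+>) A ` P) (R Quot A)"
      by (rule ring_ideal_imp_quot_ideal[OF assms(2) P.is_ideal])
    show "cring (R Quot A)"
      by (rule ideal.quotient_is_cring[OF assms(2) is_cring])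
    have "\<one> \<notin> P"
      using P.one_imp_carrier P.I_notcarr by auto
    then show "carrier (R Quot A) \<noteq> (+>) A ` P"
      unfolding carr using mem[of \<one>] by blast
    fix x y
    assume "x \<in> carrier (R Quot A)" "y \<in> carrier (R Quot A)"
      and xy: "x \<otimes>\<^bsub>R Quot A\<^esub> y \<in> (+>) A ` P"
    then obtain a b where ab: "a \<in> carrier R" "b \<in> carrier R" "x = A +> a" "y = A +> b"
      unfolding carr by blast
    then have "A +> (a \<otimes> b) \<in> (+>) A ` P"
      using xy h.hom_mult by simp
    then show "x \<in> (+>) A ` P \<or> y \<in> (+>) A ` P"
      using mem[of "a \<otimes> b"] P.I_prime[of a b] ab by auto
  qed
qed

text \<open>Primes of a quotient ring correspond to primes containing the ideal, so chains can be
  computed upstairs.\<close>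

lemma prime_chain_quot_iff:
  fixes R (structure)
  assumes "cring R" "ideal A R"
  shows "(\<exists>P. prime_chain (R Quot A) l P) \<longleftrightarrow> (\<exists>P. prime_chain R l P \<and> A \<subseteq> P 0)"
proof
  interpret cring R by fact
  interpret A: ideal A R by fact
  note carr = carrier_quot[of R A, symmetric]
  {
    assume "\<exists>P. prime_chain (R Quot A) l P"
    then obtain P where P: "prime_chain (R Quot A) l P" by blast
    have "ideal (P 0) (R Quot A)"
      using P by (auto simp: prime_chain_def primeideal_def)
    then have "A \<in> P 0"
      using additive_subgroup.zero_closed[OF ideal.axioms(1)] by (fastforce simp: FactRing_def)
    then have "A \<subseteq> {r \<in> carrier R. A +> r \<in> P 0}"
      using A.a_rcos_const A.Icarr by auto
    then show "\<exists>P. prime_chain R l P \<and> A \<subseteq> P 0"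
      using prime_chain_vimage[OF A.rcos_ring_hom_ring is_cring carr P] by blast
  next
    assume "\<exists>P. prime_chain R l P \<and> A \<subseteq> P 0"
    then obtain P where P: "prime_chain R l P" "A \<subseteq> P 0" by blast
    have sub: "A \<subseteq> P i" if "i \<le> l" for i
      using prime_chain_mono[OF P(1), of 0 i] that P(2) by auto
    have prime: "primeideal (P i) R" if "i \<le> l" for i
      using that P(1) by (simp add: prime_chain_def)
    note mem = rcos_mem_image_iff[OF ring_axioms A.is_ideal primeideal.axioms(1)[OF prime] sub]
    have "(+>) A ` P i \<subset> (+>) A ` P (Suc i)" if "i < l" for i
    proof -
      have "P i \<subset> P (Suc i)"
        using P(1) that by (simp add: prime_chain_def)
      then obtain x where x: "x \<in> P (Suc i)" "x \<notin> P i" by blast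
      then have "x \<in> carrier R"
        using ideal.Icarr[OF primeideal.axioms(1)[OF prime[of "Suc i"]]] that by simp
      then have "A +> x \<notin> (+>) A ` P i"
        using mem[of i x] that x by simp
      with x \<open>P i \<subset> P (Suc i)\<close> show ?thesis by blast
    qed
    then have "prime_chain (R Quot A) l (\<lambda>i. (+>) A ` P i)"
      using primeideal_quot_image[OF is_cring A.is_ideal prime sub] by (auto simp: prime_chain_def)
    then show "\<exists>P. prime_chain (R Quot A) l P" by blast
  }
qed

section \<open>A lower bound for the dimension\<close>

text \<open>Gaussian elimination without division. The indices in \<open>F\<close> are the free unknowns, and \<open>b j\<close>
  is the solution in which the free unknown \<open>j\<close> is nonzero and all other free unknowns vanish. A
  new equation either holds for all the \<open>b j\<close>, or fails for some \<open>b k\<close>; then \<open>k\<close> stops being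
  free, and cross-multiplication with \<open>b k\<close> repairs the other solutions. Only ring operations
  occur, so the solutions stay in any subring \<open>D\<close> that contains the coefficients.\<close>

lemma homogeneous_linear_system:
  fixes a :: "'e \<Rightarrow> 'w \<Rightarrow> 'd::idom"
  assumes "finite E" "finite W"
    and "0 \<in> D" "1 \<in> D" "\<And>x y. x \<in> D \<Longrightarrow> y \<in> D \<Longrightarrow> x - y \<in> D" "\<And>x y. x \<in> D \<Longrightarrow> y \<in> D \<Longrightarrow> x * y \<in> D"
    and "\<And>e w. e \<in> E \<Longrightarrow> w \<in> W \<Longrightarrow> a e w \<in> D"
  shows "\<exists>F b. F \<subseteq> W \<and> card W \<le> card F + card E \<and>
    (\<forall>j\<in>F. \<forall>w. b j w \<in> D) \<and> (\<forall>j\<in>F. b j j \<noteq> 0) \<and> (\<forall>j\<in>F. \<forall>i\<in>F - {j}. b j i = 0) \<and>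
    (\<forall>j\<in>F. \<forall>e\<in>E. (\<Sum>w\<in>W. a e w * b j w) = 0)"
  using assms(1,7)
proof (induction E rule: finite_induct)
  case empty
  show ?case
    by (rule exI[of _ W], rule exI[of _ "\<lambda>j w. if w = j then 1 else 0"]) (use assms(3,4) in auto)
next
  case (insert e E)
  then obtain F b where F: "F \<subseteq> W" "card W \<le> card F + card E"
    and "(\<forall>j\<in>F. \<forall>w. b j w \<in> D) \<and> (\<forall>j\<in>F. b j j \<noteq> 0) \<and> (\<forall>j\<in>F. \<forall>i\<in>F - {j}. b j i = 0) \<and>
      (\<forall>j\<in>F. \<forall>e\<in>E. (\<Sum>w\<in>W. a e w * b j w) = 0)"
    by auto
  then have b: "\<And>j w. j \<in> F \<Longrightarrow> b j w \<in> D" "\<And>j. j \<in> F \<Longrightarrow> b j j \<noteq> 0"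
    "\<And>i j. j \<in> F \<Longrightarrow> i \<in> F \<Longrightarrow> i \<noteq> j \<Longrightarrow> b j i = 0"
    "\<And>j e. j \<in> F \<Longrightarrow> e \<in> E \<Longrightarrow> (\<Sum>w\<in>W. a e w * b j w) = 0"
    by blast+
  have D_add: "x + y \<in> D" if "x \<in> D" "y \<in> D" for x y
    using assms(5)[OF that(1) assms(5)[OF assms(3) that(2)]] by simp
  have D_sum: "sum f S \<in> D" if "\<And>i. i \<in> S \<Longrightarrow> f i \<in> D" for f and S :: "'w set"
    using that by (induction S rule: infinite_finite_induct) (auto simp: assms(3) D_add)
  define \<alpha> where "\<alpha> j = (\<Sum>w\<in>W. a e w * b j w)" for j
  have \<alpha>_D: "\<alpha> j \<in> D" if "j \<in> F" for j
    unfolding \<alpha>_def using that b(1) insert.prems by (intro D_sum assms(6)) auto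
  show ?case
  proof (cases "\<forall>j\<in>F. \<alpha> j = 0")
    case True
    then have "\<forall>j\<in>F. \<forall>e'\<in>insert e E. (\<Sum>w\<in>W. a e' w * b j w) = 0"
      using b(4) by (auto simp: \<alpha>_def)
    moreover have "card W \<le> card F + card (insert e E)"
      using F(2) insert.hyps by simp
    ultimately show ?thesis
      using F(1) b(1-3) by (intro exI[of _ F] exI[of _ b] conjI) auto
  next
    case False
    then obtain k where k: "k \<in> F" "\<alpha> k \<noteq> 0" by blast
    \<comment> \<open>The value of the new equation at \<open>b' j\<close> is \<open>\<alpha> k * \<alpha> j - \<alpha> j * \<alpha> k = 0\<close>.\<close>
    define b' where "b' j w = \<alpha> k * b j w - \<alpha> j * b k w" for j w
    have lin: "(\<Sum>w\<in>W. a e' w * b' j w) = \<alpha> k * (\<Sum>w\<in>W. a e' w * b j w) - \<alpha> j * (\<Sum>w\<in>W. a e' w * b k w)" for e' j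
      by (simp add: b'_def right_diff_distrib sum_subtractf sum_distrib_left mult.left_commute)
    have "card W \<le> card (F - {k}) + card (insert e E)"
      using F insert.hyps k(1) finite_subset[OF F(1) assms(2)] by (simp add: card_Suc_Diff1)
    moreover have "b' j w \<in> D" if "j \<in> F - {k}" for j w
      unfolding b'_def using that k(1) by (intro assms(5,6) \<alpha>_D b(1)) auto
    moreover have "b' j j \<noteq> 0" if "j \<in> F - {k}" for j
      using that k b(2)[of j] b(3)[of k j] by (simp add: b'_def)
    moreover have "b' j i = 0" if "j \<in> F - {k}" "i \<in> F - {k} - {j}" for i j
      using that k b(3)[of k i] b(3)[of j i] by (simp add: b'_def)
    moreover have "(\<Sum>w\<in>W. a e' w * b' j w) = 0" if "j \<in> F - {k}" "e' \<in> insert e E" for e' j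
      using that k(1) b(4) unfolding lin by (auto simp: \<alpha>_def mult.commute)
    moreover have "F - {k} \<subseteq> W"
      using F(1) by blast
    ultimately show ?thesis
      by (intro exI[of _ "F - {k}"] exI[of _ b'] conjI ballI allI) simp_all
  qed
qed

lemma mvar_nonzero: "(mvar v :: ('v, 'a::comm_ring_1) mpoly) \<noteq> 0"
  unfolding mvar_def keys_eq_empty[symmetric] by simp

text \<open>Polynomial rings over a domain are domains; the linear order on the variables serves to
  compare monomials.\<close>

lemma primeideal_subst_kernel:
  fixes \<sigma> :: "'v \<Rightarrow> ('w::linorder, 'a::idom) mpoly"
  shows "primeideal {p \<in> polys V. subst \<sigma> p = 0} (mpoly_ring V)"
  unfolding mpoly_prime_iff mpoly_ideal_iff by auto

definition linear_form :: "'v set \<Rightarrow> 'v set \<Rightarrow> ('v, 'a::comm_ring_1) mpoly \<Rightarrow> bool" where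
  "linear_form U W f \<longleftrightarrow> (\<exists>c. (\<forall>w\<in>W. c w \<in> polys U) \<and> f = (\<Sum>w\<in>W. c w * mvar w))"

lemma linear_form_zero: "linear_form U W 0"
  unfolding linear_form_def by (rule exI[of _ "\<lambda>_. 0"]) simp

lemma linear_form_term:
  assumes "finite W" "w \<in> W" "p \<in> polys U"
  shows "linear_form U W (p * mvar w)"
proof -
  have "(\<Sum>v\<in>W. (if v = w then p else 0) * mvar v) = (\<Sum>v\<in>W. if v = w then p * mvar w else 0)"
    by (intro sum.cong) auto
  then show ?thesis
    unfolding linear_form_def using assms by (intro exI[of _ "\<lambda>v. if v = w then p else 0"]) auto
qed

lemma linear_form_diff:
  assumes "linear_form U W f" "linear_form U W g"
  shows "linear_form U W (f - g)"
proof -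
  from assms obtain c d where "\<forall>w\<in>W. c w \<in> polys U" "f = (\<Sum>w\<in>W. c w * mvar w)"
    "\<forall>w\<in>W. d w \<in> polys U" "g = (\<Sum>w\<in>W. d w * mvar w)"
    unfolding linear_form_def by blast
  then show ?thesis
    unfolding linear_form_def
    by (intro exI[of _ "\<lambda>w. c w - d w"]) (simp add: left_diff_distrib sum_subtractf)
qed

lemma linear_form_sum: "(\<And>i. i \<in> I \<Longrightarrow> linear_form U W (f i)) \<Longrightarrow> linear_form U W (sum f I)"
proof (induction I rule: infinite_finite_induct)
  case (insert i I)
  have "linear_form U W (f i - (0 - sum f I))"
    by (intro linear_form_diff linear_form_zero insert) (use insert.prems in auto)
  with insert.hyps show ?case by simp
qed (auto simp: linear_form_zero)

lemma linear_form_polys: "linear_form U W f \<Longrightarrow> f \<in> polys (U \<union> W)"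
  unfolding linear_form_def by (auto intro!: polys_sum polys_mult polys_mvar intro: polys_mono[of U])

text \<open>Since the generators are linear in the variables \<open>W\<close>, the zero set contains the image of a map
  \<open>\<phi>\<close> from an affine space with coordinates \<open>U\<close> and \<open>F\<close>, where \<open>F \<subseteq> W\<close> are the free unknowns:
  it keeps \<open>U\<close> and sends a point of \<open>F\<close>-space to the corresponding combination of the basic
  solutions. Pulling back the primes generated by longer and longer lists of coordinates gives
  a chain. It is strict because the coordinate \<open>z\<close> itself witnesses the step at which \<open>z\<close> is
  killed: its image under \<open>\<phi>\<close> is \<open>z\<close> times a nonzero polynomial in \<open>U\<close>. For this the
  coordinates in \<open>F\<close> have to be killed before those in \<open>U\<close>.\<close>

lemma krull_dim_linear_ge:
  fixes S :: "('v::linorder, 'a::idom) mpoly set"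
  assumes fin: "finite U" "finite W" "finite S" and disj: "U \<inter> W = {}"
    and lin: "\<And>f. f \<in> S \<Longrightarrow> linear_form U W f"
    and l: "l + card S \<le> card U + card W"
  shows "ereal (real l) \<le> krull_dim (mpoly_ring (U \<union> W) Quot genideal (mpoly_ring (U \<union> W)) S)"
proof -
  let ?V = "U \<union> W"
  obtain c where c: "\<And>f w. f \<in> S \<Longrightarrow> w \<in> W \<Longrightarrow> c f w \<in> polys U"
    "\<And>f. f \<in> S \<Longrightarrow> f = (\<Sum>w\<in>W. c f w * mvar w)"
    using lin unfolding linear_form_def by metis
  have S_sub: "S \<subseteq> polys ?V"
    using lin linear_form_polys by blast
  obtain F b where F: "F \<subseteq> W" "card W \<le> card F + card S"
    and "(\<forall>j\<in>F. \<forall>w. b j w \<in> polys U) \<and> (\<forall>j\<in>F. b j j \<noteq> 0) \<and> (\<forall>j\<in>F. \<forall>i\<in>F - {j}. b j i = 0) \<and>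
      (\<forall>j\<in>F. \<forall>f\<in>S. (\<Sum>w\<in>W. c f w * b j w) = 0)"
    using homogeneous_linear_system[of S W "polys U" c] fin c(1) by auto
  then have b: "\<And>j w. j \<in> F \<Longrightarrow> b j w \<in> polys U" "\<And>j. j \<in> F \<Longrightarrow> b j j \<noteq> 0"
    "\<And>i j. j \<in> F \<Longrightarrow> i \<in> F \<Longrightarrow> i \<noteq> j \<Longrightarrow> b j i = 0"
    "\<And>j f. j \<in> F \<Longrightarrow> f \<in> S \<Longrightarrow> (\<Sum>w\<in>W. c f w * b j w) = 0"
    by blast+
  have finF: "finite F"
    using F(1) fin(2) finite_subset by blast
  \<comment> \<open>The free unknown \<open>j \<in> F\<close> doubles as the coordinate in front of the solution \<open>b j\<close>.\<close>
  define \<phi> where "\<phi> v = (if v \<in> W then \<Sum>j\<in>F. b j v * mvar j else mvar v)" for v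
  define kill where "kill T v = (if v \<in> T then 0 else mvar v :: ('v, 'a) mpoly)" for T v
  define Q where "Q T = {p \<in> polys ?V. subst (kill T) (subst \<phi> p) = 0}" for T
  have Q_prime: "primeideal (Q T) (mpoly_ring ?V)" for T
    unfolding Q_def subst_subst by (rule primeideal_subst_kernel)
  have "subst \<phi> f = 0" if "f \<in> S" for f
  proof -
    have "subst \<phi> f = (\<Sum>w\<in>W. subst \<phi> (c f w) * \<phi> w)"
      by (subst c(2)[OF that]) (simp add: subst_sum)
    also have "\<dots> = (\<Sum>w\<in>W. c f w * (\<Sum>j\<in>F. b j w * mvar j))"
      using disj by (intro sum.cong arg_cong2[where f = "(*)"] subst_eq_self[OF c(1)[OF that]])
        (auto simp: \<phi>_def)
    also have "\<dots> = (\<Sum>j\<in>F. (\<Sum>w\<in>W. c f w * b j w) * mvar j)"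
      by (simp add: sum_distrib_left sum_distrib_right mult.assoc) (rule sum.swap)
    also have "\<dots> = 0"
      using b(4)[OF _ that] by simp
    finally show ?thesis .
  qed
  then have "S \<subseteq> Q {}"
    using S_sub by (auto simp: Q_def)
  then have gen: "genideal (mpoly_ring ?V) S \<subseteq> Q {}"
    by (intro genideal_mpoly_minimal primeideal.axioms(1) Q_prime)
  have Q_mono: "Q T \<subseteq> Q (insert z T)" for T z
  proof -
    have "subst (kill (insert z T)) (subst (kill T) q) = subst (kill (insert z T)) q" for q
      unfolding subst_subst
      by (rule arg_cong[where f = "\<lambda>\<sigma>. subst \<sigma> q"]) (auto simp: kill_def)
    note killed = this
    show ?thesis
    proof
      fix p assume p: "p \<in> Q T"
      then have "subst (kill T) (subst \<phi> p) = 0"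
        by (simp add: Q_def)
      from killed[of "subst \<phi> p", unfolded this] p show "p \<in> Q (insert z T)"
        by (simp add: Q_def)
    qed
  qed
  obtain fs us where L: "set fs = F" "distinct fs" "set us = U" "distinct us"
    using fin finF finite_distinct_list by metis
  define L where "L = fs @ us"
  have distL: "distinct L"
    using L F(1) disj by (auto simp: L_def)
  have strict: "Q (set (take i L)) \<subset> Q (set (take (Suc i) L))" if i: "i < length L" for i
  proof -
    define T z where "T = set (take i L)" and "z = L ! i"
    have T': "set (take (Suc i) L) = insert z T"
      using i by (simp add: T_def z_def take_Suc_conv_app_nth)
    have "z \<notin> T"
      using distL i by (simp add: T_def z_def in_set_conv_nth nth_eq_iff_index_eq)
    have zL: "z \<in> set L"
      using i by (simp add: z_def)
    have "mvar z \<in> Q (insert z T) - Q T"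
    proof (cases "z \<in> F")
      case True
      have "i < length fs"
      proof (rule ccontr)
        assume "\<not> i < length fs"
        then have "z \<in> U"
          using i L by (auto simp: z_def L_def nth_append)
        with True F(1) disj show False by blast
      qed
      then have "T \<subseteq> F"
        using L(1) by (auto simp: T_def L_def dest: in_set_takeD)
      have "\<phi> z = (\<Sum>j\<in>F. if j = z then b z z * mvar z else 0)"
        unfolding \<phi>_def using True F(1) b(3) by (auto intro!: sum.cong)
      also have "\<dots> = b z z * mvar z"
        using True finF by simp
      finally have "\<phi> z = b z z * mvar z" .
      moreover have "subst (kill T) (b z z) = b z z"
        using \<open>T \<subseteq> F\<close> F(1) disj by (intro subst_eq_self[OF b(1)[OF True]]) (auto simp: kill_def)
      ultimately show ?thesis
        using \<open>z \<notin> T\<close> True F(1) b(2)[OF True] by (auto simp: Q_def kill_def mvar_nonzero)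
    next
      case False
      then have "z \<in> U"
        using zL L by (auto simp: L_def)
      then have "\<phi> z = mvar z"
        using disj by (auto simp: \<phi>_def)
      then show ?thesis
        using \<open>z \<notin> T\<close> \<open>z \<in> U\<close> by (auto simp: Q_def kill_def mvar_nonzero)
    qed
    then show ?thesis
      using Q_mono[of T z] unfolding T' T_def[symmetric] by blast
  qed
  have "l \<le> length L"
    using L l F(2) distinct_card[of fs] distinct_card[of us] by (simp add: L_def)
  then have "prime_chain (mpoly_ring ?V) l (\<lambda>i. Q (set (take i L)))"
    using Q_prime strict by (simp add: prime_chain_def)
  then have "\<exists>P. prime_chain (mpoly_ring ?V Quot genideal (mpoly_ring ?V) S) l P"
    using gen by (subst prime_chain_quot_iff[OF cring_mpoly_ring ideal_genideal_mpoly[OF S_sub]])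
      (auto intro!: exI[of _ "\<lambda>i. Q (set (take i L))"])
  then show ?thesis
    unfolding krull_dim_prime_chain by (intro SUP_upper) simp
qed

section \<open>Homogeneous components\<close>

lemma mdeg_superset:
  assumes "finite S" "Poly_Mapping.keys m \<subseteq> S"
  shows "mdeg m = (\<Sum>v\<in>S. Poly_Mapping.lookup m v)"
  unfolding mdeg_def
  by (rule sum.mono_neutral_left) (use assms in \<open>auto simp: in_keys_iff\<close>)

lemma mdeg_add: "mdeg (m + m') = mdeg m + mdeg m'"
proof -
  let ?S = "Poly_Mapping.keys m \<union> Poly_Mapping.keys m'"
  have "mdeg (m + m') = (\<Sum>v\<in>?S. Poly_Mapping.lookup (m + m') v)"
    using Poly_Mapping.keys_add[of m m'] by (intro mdeg_superset) auto
  then show ?thesis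
    by (simp add: mdeg_superset[of ?S] lookup_add sum.distrib)
qed

lemma homogeneous_single: "homogeneous (mdeg m) (Poly_Mapping.single m c)"
  by (simp add: homogeneous_def)

lemma homogeneous_mvar: "homogeneous 1 (mvar v)"
  by (simp add: homogeneous_def mvar_def mdeg_def)

lemma homogeneous_zero [simp]: "homogeneous d 0"
  by (simp add: homogeneous_def)

lemma homogeneous_add: "homogeneous d p \<Longrightarrow> homogeneous d q \<Longrightarrow> homogeneous d (p + q)"
  using Poly_Mapping.keys_add[of p q] by (auto simp: homogeneous_def)

lemma homogeneous_uminus: "homogeneous d p \<Longrightarrow> homogeneous d (- p)"
  by (simp add: homogeneous_def)

lemma homogeneous_diff: "homogeneous d p \<Longrightarrow> homogeneous d q \<Longrightarrow> homogeneous d (p - q)"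
  using homogeneous_add[of d p "- q"] homogeneous_uminus[of d q] by simp

lemma homogeneous_sum: "(\<And>i. i \<in> S \<Longrightarrow> homogeneous d (f i)) \<Longrightarrow> homogeneous d (sum f S)"
  by (induction S rule: infinite_finite_induct) (auto simp: homogeneous_add)

lemma homogeneous_mult: "homogeneous d p \<Longrightarrow> homogeneous e q \<Longrightarrow> homogeneous (d + e) (p * q)"
  using Poly_Mapping.keys_mult[of p q] by (fastforce simp: homogeneous_def mdeg_add)

definition hcomp :: "nat \<Rightarrow> ('v, 'a::comm_ring_1) mpoly \<Rightarrow> ('v, 'a) mpoly" where
  "hcomp d p = (\<Sum>m\<in>{m \<in> Poly_Mapping.keys p. mdeg m = d}.
     Poly_Mapping.single m (Poly_Mapping.lookup p m))"

lemma lookup_hcomp: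
  "Poly_Mapping.lookup (hcomp d p) m = (if mdeg m = d then Poly_Mapping.lookup p m else 0)"
  by (auto simp: hcomp_def lookup_sum lookup_single when_def in_keys_iff)

lemma hcomp_zero [simp]: "hcomp d 0 = 0"
  by (simp add: hcomp_def)

lemma hcomp_add: "hcomp d (p + q) = hcomp d p + hcomp d q"
  by (rule poly_mapping_eqI) (simp add: lookup_hcomp lookup_add)

lemma hcomp_sum: "hcomp d (sum f S) = (\<Sum>i\<in>S. hcomp d (f i))"
  by (induction S rule: infinite_finite_induct) (auto simp: hcomp_add)

lemma hcomp_homogeneous: "homogeneous e p \<Longrightarrow> hcomp d p = (if d = e then p else 0)"
  by (rule poly_mapping_eqI) (auto simp: lookup_hcomp homogeneous_def in_keys_iff)

lemma homogeneous_hcomp: "homogeneous d (hcomp d p)"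
  by (auto simp: homogeneous_def in_keys_iff lookup_hcomp split: if_splits)

lemma polys_hcomp: "p \<in> polys V \<Longrightarrow> hcomp d p \<in> polys V"
  by (auto simp: polys_iff in_keys_iff[of _ "hcomp d p"] in_keys_iff[of _ p] lookup_hcomp
      split: if_splits)

lemma hcomp_mult:
  assumes "homogeneous e h"
  shows "hcomp d (h * p) = (if e \<le> d then h * hcomp (d - e) p else 0)"
proof (induction p rule: mpoly_induct)
  case (single m c)
  show ?case
    using hcomp_homogeneous[OF homogeneous_mult[OF assms homogeneous_single[of m c]], of d]
      hcomp_homogeneous[OF homogeneous_single[of m c], of "d - e"] by auto
qed (simp_all add: distrib_left hcomp_add)

text \<open>The polynomials all of whose components lie in the ideal form an ideal themselves, because it
  suffices to multiply by monomials, and these only shift the degree.\<close>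

lemma hcomp_genideal:
  assumes S: "S \<subseteq> polys V" "\<And>f. f \<in> S \<Longrightarrow> \<exists>d. homogeneous d f"
    and "p \<in> genideal (mpoly_ring V) S"
  shows "hcomp d p \<in> genideal (mpoly_ring V) S"
proof -
  let ?A = "genideal (mpoly_ring V) S"
  note A = mpoly_idealD[OF ideal_genideal_mpoly[OF S(1)]]
  have "ideal {p \<in> polys V. \<forall>d. hcomp d p \<in> ?A} (mpoly_ring V)"
  proof (unfold mpoly_ideal_iff, intro conjI ballI)
    fix p r :: "('a, 'b) mpoly"
    assume p: "p \<in> {p \<in> polys V. \<forall>d. hcomp d p \<in> ?A}" and r: "r \<in> polys V"
    have "\<forall>d. hcomp d (r * p) \<in> ?A"
    proof (induction r rule: mpoly_induct)
      case (single m c)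
      have "Poly_Mapping.single m c \<in> polys V"
        using single r by (auto simp: polys_iff)
      then show ?case
        using p A by (auto simp: hcomp_mult[OF homogeneous_single])
    qed (use A in \<open>auto simp: distrib_right hcomp_add\<close>)
    with p r show "r * p \<in> {p \<in> polys V. \<forall>d. hcomp d p \<in> ?A}" by simp
  qed (use A in \<open>auto simp: hcomp_add\<close>)
  moreover have "S \<subseteq> {p \<in> polys V. \<forall>d. hcomp d p \<in> ?A}"
  proof
    fix f assume f: "f \<in> S"
    then obtain e where "homogeneous e f"
      using S(2) by blast
    then have "hcomp d f \<in> ?A" for d
      using genideal_mpoly_superset[OF S(1)] A f by (auto simp: hcomp_homogeneous)
    then show "f \<in> {p \<in> polys V. \<forall>d. hcomp d p \<in> ?A}"
      using S(1) f by blast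
  qed
  ultimately show ?thesis
    using genideal_mpoly_minimal assms(3) by blast
qed

section \<open>An upper bound for the dimension\<close>

text \<open>Elements picked from the steps of a chain of primes are algebraically independent modulo its
  bottom prime, as in the description of dimension by Coquand and Lombardi. Suppose that a
  relation among \<open>x j, \<dots>, x (l - 1)\<close> holds modulo \<open>P j\<close>. Divide it by the lowest power of \<open>x j\<close> that
  occurs; this is possible because \<open>x j \<notin> P j\<close>. Modulo \<open>P (Suc j)\<close>, which contains \<open>x j\<close>, only
  the terms of lowest degree in \<open>x j\<close> survive, a relation among the remaining elements. At the
  end a nonzero constant would lie in \<open>P l\<close>.\<close>

lemma prime_chain_power_products_independent:
  fixes x :: "nat \<Rightarrow> ('v, 'a::field) mpoly"
  assumes chain: "prime_chain (mpoly_ring V) l P"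
    and x: "\<And>i. i < l \<Longrightarrow> x i \<in> P (Suc i) - P i"
    and "j \<le> l" "finite E" "inj_on (\<lambda>\<alpha>. restrict \<alpha> {j..<l}) E"
    and "(\<Sum>\<alpha>\<in>E. Poly_Mapping.single 0 (c \<alpha>) * (\<Prod>i\<in>{j..<l}. x i ^ \<alpha> i)) \<in> P j"
  shows "\<forall>\<alpha>\<in>E. c \<alpha> = 0"
  using assms(3-)
proof (induction j arbitrary: E rule: inc_induct)
  case base
  have P: "ideal (P l) (mpoly_ring V)" "1 \<notin> P l"
    using chain by (auto simp: prime_chain_def mpoly_prime_iff)
  show ?case
  proof
    fix \<alpha> assume \<alpha>: "\<alpha> \<in> E"
    then have "E = {\<alpha>}"
      using base(2) by (auto simp: inj_on_def)
    then have "Poly_Mapping.single 0 (c \<alpha>) \<in> P l"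
      using base(3) by simp
    then have "Poly_Mapping.single 0 (inverse (c \<alpha>)) * Poly_Mapping.single 0 (c \<alpha>) \<in> P l"
      by (intro mpoly_ideal_mult[OF P(1)] polys_single) auto
    then show "c \<alpha> = 0"
      using P(2) by (cases "c \<alpha> = 0") (simp_all add: mult_single)
  qed
next
  case (step j)
  have Pj: "primeideal (P j) (mpoly_ring V)" "ideal (P j) (mpoly_ring V)"
    and PS: "ideal (P (Suc j)) (mpoly_ring V)" and sub: "P j \<subseteq> P (Suc j)"
    using chain step(2) by (auto simp: prime_chain_def mpoly_prime_iff)
  have xP: "x i \<in> polys V" if "i < l" for i
  proof -
    have "ideal (P (Suc i)) (mpoly_ring V)"
      using chain that by (auto simp: prime_chain_def mpoly_prime_iff)
    then show ?thesis
      using x[OF that] mpoly_idealD by blast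
  qed
  define R where "R \<alpha> = (\<Prod>i\<in>{Suc j..<l}. x i ^ \<alpha> i)" for \<alpha> :: "nat \<Rightarrow> nat"
  have R: "R \<alpha> \<in> polys V" for \<alpha>
    unfolding R_def by (intro polys_prod polys_power xP) auto
  have split: "(\<Prod>i\<in>{j..<l}. x i ^ \<alpha> i) = x j ^ \<alpha> j * R \<alpha>" for \<alpha>
    unfolding R_def using step(2) by (simp add: prod.atLeast_Suc_lessThan)
  define E0 where "E0 = {\<alpha> \<in> E. c \<alpha> \<noteq> 0}"
  show ?case
  proof (rule ccontr)
    assume "\<not> ?case"
    then have "E0 \<noteq> {}" "finite E0"
      using step.prems(1) by (auto simp: E0_def)
    \<comment> \<open>The lowest power of \<open>x j\<close> in the relation.\<close>
    define d where "d = Min ((\<lambda>\<alpha>. \<alpha> j) ` E0)"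
    have d_le: "d \<le> \<alpha> j" if "\<alpha> \<in> E0" for \<alpha>
      using that \<open>finite E0\<close> by (simp add: d_def)
    have "d \<in> (\<lambda>\<alpha>. \<alpha> j) ` E0"
      unfolding d_def using \<open>E0 \<noteq> {}\<close> \<open>finite E0\<close> by (intro Min_in) auto
    then obtain \<alpha>0 where \<alpha>0: "\<alpha>0 \<in> E0" "\<alpha>0 j = d" by auto
    let ?t = "\<lambda>\<alpha>. Poly_Mapping.single 0 (c \<alpha>) * (x j ^ (\<alpha> j - d) * R \<alpha>)"
    have t_polys: "Poly_Mapping.single 0 (c \<alpha>) * (x j ^ e * R \<alpha>) \<in> polys V" for \<alpha> e
      using step(2) by (intro polys_mult polys_power xP R polys_single) auto
    have "(\<Sum>\<alpha>\<in>E. Poly_Mapping.single 0 (c \<alpha>) * (x j ^ \<alpha> j * R \<alpha>))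
        = (\<Sum>\<alpha>\<in>E0. Poly_Mapping.single 0 (c \<alpha>) * (x j ^ \<alpha> j * R \<alpha>))"
      unfolding E0_def using step.prems(1) by (intro sum.mono_neutral_right) auto
    also have "\<dots> = (\<Sum>\<alpha>\<in>E0. x j ^ d * ?t \<alpha>)"
    proof (intro sum.cong refl)
      fix \<alpha> assume "\<alpha> \<in> E0"
      then have "x j ^ \<alpha> j = x j ^ d * x j ^ (\<alpha> j - d)"
        using d_le by (simp flip: power_add)
      then show "Poly_Mapping.single 0 (c \<alpha>) * (x j ^ \<alpha> j * R \<alpha>) = x j ^ d * ?t \<alpha>"
        by (simp add: mult_ac)
    qed
    also have "\<dots> = x j ^ d * (\<Sum>\<alpha>\<in>E0. ?t \<alpha>)"
      by (simp add: sum_distrib_left)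
    finally have "x j ^ d * (\<Sum>\<alpha>\<in>E0. ?t \<alpha>) \<in> P j"
      using step.prems(3) unfolding split by simp
    moreover have "x j ^ e \<notin> P j" for e
    proof (induction e)
      case 0
      show ?case using Pj(1) by (simp add: mpoly_prime_iff)
    next
      case (Suc e)
      then show ?case
        using Pj(1) x[OF step(2)] xP[OF step(2)] by (auto simp: mpoly_prime_iff)
    qed
    moreover have "(\<Sum>\<alpha>\<in>E0. ?t \<alpha>) \<in> polys V"
      by (intro polys_sum t_polys)
    ultimately have "(\<Sum>\<alpha>\<in>E0. ?t \<alpha>) \<in> P j"
      using Pj(1) xP[OF step(2)] polys_power unfolding mpoly_prime_iff by blast
    then have 1: "(\<Sum>\<alpha>\<in>E0. ?t \<alpha>) \<in> P (Suc j)"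
      using sub by blast
    define E1 where "E1 = {\<alpha> \<in> E0. \<alpha> j = d}"
    have 2: "(\<Sum>\<alpha>\<in>E0 - E1. ?t \<alpha>) \<in> P (Suc j)"
    proof (intro mpoly_ideal_sum[OF PS])
      fix \<alpha> assume "\<alpha> \<in> E0 - E1"
      then have "\<alpha> j - d = Suc (\<alpha> j - d - 1)"
        using d_le[of \<alpha>] by (auto simp: E1_def)
      then have "x j ^ (\<alpha> j - d) = x j ^ (\<alpha> j - d - 1) * x j"
        by (metis power_Suc2)
      then have "?t \<alpha> = Poly_Mapping.single 0 (c \<alpha>) * (x j ^ (\<alpha> j - d - 1) * R \<alpha>) * x j"
        by (simp add: mult_ac)
      then show "?t \<alpha> \<in> P (Suc j)"
        using t_polys x[OF step(2)] mpoly_idealD[OF PS] by simp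
    qed
    have "(\<Sum>\<alpha>\<in>E0. ?t \<alpha>) - (\<Sum>\<alpha>\<in>E0 - E1. ?t \<alpha>) = (\<Sum>\<alpha>\<in>E1. ?t \<alpha>)"
      using \<open>finite E0\<close> by (subst sum_diff) (auto simp: E1_def)
    also have "\<dots> = (\<Sum>\<alpha>\<in>E1. Poly_Mapping.single 0 (c \<alpha>) * (\<Prod>i\<in>{Suc j..<l}. x i ^ \<alpha> i))"
      by (intro sum.cong) (auto simp: E1_def R_def)
    finally have sum1: "(\<Sum>\<alpha>\<in>E1. Poly_Mapping.single 0 (c \<alpha>) * (\<Prod>i\<in>{Suc j..<l}. x i ^ \<alpha> i)) \<in> P (Suc j)"
      using mpoly_ideal_diff[OF PS 1 2] by simp
    have "inj_on (\<lambda>\<alpha>. restrict \<alpha> {Suc j..<l}) E1"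
    proof (rule inj_onI)
      fix \<alpha> \<beta> assume ab: "\<alpha> \<in> E1" "\<beta> \<in> E1" "restrict \<alpha> {Suc j..<l} = restrict \<beta> {Suc j..<l}"
      have "\<alpha> i = \<beta> i" if "i \<in> {j..<l}" for i
      proof (cases "i = j")
        case False
        then have "i \<in> {Suc j..<l}" using that by auto
        then show ?thesis using ab(3) by (metis restrict_apply')
      qed (use ab in \<open>auto simp: E1_def\<close>)
      then have "restrict \<alpha> {j..<l} = restrict \<beta> {j..<l}"
        by (rule restrict_ext)
      moreover have "\<alpha> \<in> E" "\<beta> \<in> E"
        using ab(1,2) by (simp_all add: E1_def E0_def)
      ultimately show "\<alpha> = \<beta>"
        by (rule inj_onD[OF step.prems(2)])
    qed
    moreover have "finite E1"
      using \<open>finite E0\<close> by (simp add: E1_def)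
    ultimately have "\<forall>\<alpha>\<in>E1. c \<alpha> = 0"
      by (intro step.IH[OF _ _ sum1])
    then show False
      using \<alpha>0 by (auto simp: E1_def E0_def)
  qed
qed

text \<open>The span and its calculus come from viewing polynomials over a field as a vector space.\<close>

interpretation mpoly_space: vector_space "\<lambda>(c::'a::field) (p::('v, 'a) mpoly). Poly_Mapping.single 0 c * p"
  by unfold_locales (simp_all add: distrib_left distrib_right single_add mult_single flip: mult.assoc)

lemma lookup_le_mdeg: "Poly_Mapping.lookup m v \<le> mdeg m"
proof (cases "v \<in> Poly_Mapping.keys m")
  case True
  then show ?thesis
    unfolding mdeg_def by (intro member_le_sum) auto
qed (simp add: in_keys_iff)

lemma finite_monomials:
  assumes "finite V"
  shows "finite {m. Poly_Mapping.keys m \<subseteq> V \<and> mdeg m < D}"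
proof -
  have "Poly_Mapping.lookup ` {m. Poly_Mapping.keys m \<subseteq> V \<and> mdeg m < D}
      \<subseteq> {f. (\<forall>v. (v \<in> V \<longrightarrow> f v \<in> {..<D}) \<and> (v \<notin> V \<longrightarrow> f v = 0))}"
    using le_less_trans[OF lookup_le_mdeg] by (auto simp: subset_iff in_keys_iff)
  moreover have "finite {f :: 'a \<Rightarrow> nat. (\<forall>v. (v \<in> V \<longrightarrow> f v \<in> {..<D}) \<and> (v \<notin> V \<longrightarrow> f v = 0))}"
    by (rule finite_set_of_finite_funs) (use assms in auto)
  ultimately have "finite (Poly_Mapping.lookup ` {m. Poly_Mapping.keys m \<subseteq> V \<and> mdeg m < D})"
    by (rule finite_subset)
  then show ?thesis
    by (rule finite_imageD) (auto intro: inj_onI poly_mapping_eqI)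
qed

lemma single_factor_variable:
  assumes "n \<le> Poly_Mapping.lookup m v"
  shows "Poly_Mapping.single m c = Poly_Mapping.single (m - Poly_Mapping.single v n) c * mvar v ^ n"
proof -
  have "m = (m - Poly_Mapping.single v n) + Poly_Mapping.single v n"
    using assms by (intro poly_mapping_eqI) (auto simp: lookup_add lookup_minus lookup_single when_def)
  then show ?thesis
    by (simp add: mvar_power mult_single)
qed

lemma keys_minus_subset: "Poly_Mapping.keys (m - m') \<subseteq> Poly_Mapping.keys (m :: 'v \<Rightarrow>\<^sub>0 nat)"
  by (auto simp: in_keys_iff lookup_minus)

text \<open>By the pigeonhole principle a monomial of high degree contains a high power of some variable.\<close>

lemma high_monomials_in_ideal:
  fixes J :: "('v, 'a::comm_ring_1) mpoly set"
  assumes J: "ideal J (mpoly_ring V)" and "finite V" and "\<And>v. v \<in> V \<Longrightarrow> \<exists>n. mvar v ^ n \<in> J"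
  shows "\<exists>D. \<forall>m. Poly_Mapping.keys m \<subseteq> V \<longrightarrow> mdeg m \<ge> D \<longrightarrow> Poly_Mapping.single m 1 \<in> J"
proof -
  obtain N where N: "\<And>v. v \<in> V \<Longrightarrow> mvar v ^ N v \<in> J"
    using assms(3) by metis
  have "Poly_Mapping.single m 1 \<in> J"
    if m: "Poly_Mapping.keys m \<subseteq> V" "mdeg m \<ge> Suc (\<Sum>v\<in>V. N v)" for m
  proof -
    have "\<exists>v\<in>V. N v \<le> Poly_Mapping.lookup m v"
    proof (rule ccontr)
      assume "\<not> ?thesis"
      then have "(\<Sum>v\<in>V. Poly_Mapping.lookup m v) \<le> (\<Sum>v\<in>V. N v)"
        by (intro sum_mono) (auto simp: not_le)
      then show False
        using m mdeg_superset[OF assms(2) m(1)] by simp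
    qed
    then obtain v where v: "v \<in> V" "N v \<le> Poly_Mapping.lookup m v" by blast
    have "Poly_Mapping.single (m - Poly_Mapping.single v (N v)) 1 \<in> polys V"
      by (rule polys_single[OF order_trans[OF keys_minus_subset m(1)]])
    then show ?thesis
      by (subst single_factor_variable[OF v(2)]) (rule mpoly_ideal_mult[OF J N[OF v(1)]])
  qed
  then show ?thesis by blast
qed

text \<open>An arbitrary expression of \<open>p\<close> through \<open>A\<close> and \<open>\<theta>\<close> may be replaced by its component of
  degree \<open>d\<close>. Then the coefficients \<open>g j\<close> have smaller degree than \<open>p\<close>, which is what the induction
  in \<open>homogeneous_in_span_mod\<close> needs.\<close>

lemma homogeneous_decomposition:
  fixes A :: "('v, 'a::comm_ring_1) mpoly set" and \<theta> :: "('v, 'a) mpoly list"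
  assumes A: "homogeneous_ideal V A"
    and \<theta>: "set \<theta> \<subseteq> polys V" "\<And>j. j < length \<theta> \<Longrightarrow> homogeneous (e j) (\<theta> ! j)"
    and p: "homogeneous d p" "p \<in> genideal (mpoly_ring V) (A \<union> set \<theta>)"
  shows "\<exists>a\<in>A. \<exists>g. p = a + (\<Sum>j<length \<theta>. \<theta> ! j * g j) \<and>
    (\<forall>j. g j \<in> polys V \<and> (g j = 0 \<or> e j \<le> d \<and> homogeneous (d - e j) (g j)))"
proof -
  obtain S where S: "S \<subseteq> polys V" "\<And>f. f \<in> S \<Longrightarrow> \<exists>d. homogeneous d f"
    and AS: "A = genideal (mpoly_ring V) S"
    using A by (auto simp: homogeneous_ideal_def)
  have A_ideal: "ideal A (mpoly_ring V)"
    unfolding AS by (rule ideal_genideal_mpoly[OF S(1)])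
  let ?B = "{p. \<exists>a\<in>A. \<exists>g. p = a + (\<Sum>j<length \<theta>. \<theta> ! j * g j) \<and> (\<forall>j. g j \<in> polys V)}"
  have \<theta>_polys: "\<theta> ! j \<in> polys V" if "j < length \<theta>" for j
    using that \<theta>(1) by auto
  have B: "ideal ?B (mpoly_ring V)"
  proof (unfold mpoly_ideal_iff, intro conjI ballI subsetI)
    fix p assume "p \<in> ?B"
    then show "p \<in> polys V"
      using mpoly_ideal_polys[OF A_ideal] \<theta>_polys by (auto intro!: polys_add polys_sum polys_mult)
  next
    show "0 \<in> ?B"
      using mpoly_idealD[OF A_ideal] by (auto intro!: bexI[of _ 0] exI[of _ "\<lambda>_. 0"])
  next
    fix p q assume "p \<in> ?B" "q \<in> ?B"
    then obtain a b g h where "a \<in> A" "b \<in> A" "\<forall>j. g j \<in> polys V" "\<forall>j. h j \<in> polys V"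
      "p = a + (\<Sum>j<length \<theta>. \<theta> ! j * g j)" "q = b + (\<Sum>j<length \<theta>. \<theta> ! j * h j)"
      by blast
    then show "p + q \<in> ?B"
      using mpoly_ideal_add[OF A_ideal]
      by (auto intro!: bexI[of _ "a + b"] exI[of _ "\<lambda>j. g j + h j"]
          simp: algebra_simps sum.distrib)
  next
    fix p r :: "('v, 'a) mpoly" assume "p \<in> ?B" "r \<in> polys V"
    then obtain a g where "a \<in> A" "\<forall>j. g j \<in> polys V" "p = a + (\<Sum>j<length \<theta>. \<theta> ! j * g j)"
      by blast
    then show "r * p \<in> ?B"
      using mpoly_ideal_mult[OF A_ideal] \<open>r \<in> polys V\<close>
      by (auto intro!: bexI[of _ "r * a"] exI[of _ "\<lambda>j. r * g j"]
          simp: distrib_left sum_distrib_left mult_ac)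
  qed
  have "A \<union> set \<theta> \<subseteq> ?B"
  proof (intro Un_least subsetI)
    fix a assume "a \<in> A"
    then show "a \<in> ?B"
      by (auto intro!: bexI[of _ a] exI[of _ "\<lambda>_. 0"])
  next
    fix q assume "q \<in> set \<theta>"
    then obtain i where i: "i < length \<theta>" "q = \<theta> ! i"
      by (auto simp: in_set_conv_nth)
    have "(\<Sum>j<length \<theta>. \<theta> ! j * (if j = i then 1 else 0)) = (\<Sum>j<length \<theta>. if j = i then \<theta> ! i else 0)"
      by (intro sum.cong) auto
    then have "q = 0 + (\<Sum>j<length \<theta>. \<theta> ! j * (if j = i then 1 else 0))"
      using i by simp
    moreover have "0 \<in> A"
      using mpoly_idealD[OF A_ideal] by blast
    ultimately show "q \<in> ?B"
      by (intro CollectI bexI[of _ 0] exI[of _ "\<lambda>j. if j = i then 1 else 0"]) auto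
  qed
  with p(2) B obtain a g where a: "a \<in> A" and g: "\<And>j. g j \<in> polys V"
    and eq: "p = a + (\<Sum>j<length \<theta>. \<theta> ! j * g j)"
    using genideal_mpoly_minimal[OF B] by blast
  define g' where "g' j = (if e j \<le> d then hcomp (d - e j) (g j) else 0)" for j
  have "p = hcomp d p"
    using hcomp_homogeneous[OF p(1)] by simp
  also have "\<dots> = hcomp d a + (\<Sum>j<length \<theta>. \<theta> ! j * g' j)"
    unfolding eq hcomp_add hcomp_sum
    by (intro arg_cong2[where f = "(+)"] sum.cong refl) (simp add: hcomp_mult[OF \<theta>(2)] g'_def)
  finally have "p = hcomp d a + (\<Sum>j<length \<theta>. \<theta> ! j * g' j)" .
  moreover have "hcomp d a \<in> A"
    using a hcomp_genideal[OF S] unfolding AS by blast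
  moreover have "g' j \<in> polys V \<and> (g' j = 0 \<or> e j \<le> d \<and> homogeneous (d - e j) (g' j))" for j
    using g[of j] by (auto simp: g'_def polys_hcomp homogeneous_hcomp)
  ultimately show ?thesis by blast
qed

text \<open>The span of \<open>T\<close> modulo \<open>A\<close>, as a set of representatives: this avoids a vector space structure
  on the quotient ring.\<close>

definition span_mod :: "('v, 'a::field) mpoly set \<Rightarrow> ('v, 'a) mpoly set \<Rightarrow> ('v, 'a) mpoly set" where
  "span_mod A T = {p. \<exists>a\<in>A. p - a \<in> mpoly_space.span T}"

lemma span_mod_ideal: "ideal A (mpoly_ring V) \<Longrightarrow> a \<in> A \<Longrightarrow> a \<in> span_mod A T"
  by (auto simp: span_mod_def mpoly_space.span_zero intro!: bexI[of _ a])

lemma span_mod_add: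
  assumes "ideal A (mpoly_ring V)" "p \<in> span_mod A T" "q \<in> span_mod A T"
  shows "p + q \<in> span_mod A T"
proof -
  from assms(2,3) obtain a b where ab: "a \<in> A" "b \<in> A" "p - a \<in> mpoly_space.span T" "q - b \<in> mpoly_space.span T"
    by (auto simp: span_mod_def)
  then have "p + q - (a + b) \<in> mpoly_space.span T"
    using mpoly_space.span_add[OF ab(3,4)] by (simp add: algebra_simps)
  then show ?thesis
    using ab mpoly_ideal_add[OF assms(1)] by (auto simp: span_mod_def)
qed

lemma span_mod_sum:
  assumes "ideal A (mpoly_ring V)" "\<And>i. i \<in> I \<Longrightarrow> f i \<in> span_mod A T"
  shows "sum f I \<in> span_mod A T"
proof -
  have "0 \<in> span_mod A T"
    using span_mod_ideal[OF assms(1)] mpoly_idealD[OF assms(1)] by blast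
  then show ?thesis
    using assms(2) by (induction I rule: infinite_finite_induct) (auto intro: span_mod_add[OF assms(1)])
qed

lemma span_mod_mult:
  assumes "ideal A (mpoly_ring V)" "h \<in> polys V" "\<And>t. t \<in> T \<Longrightarrow> h * t \<in> T'" "p \<in> span_mod A T"
  shows "h * p \<in> span_mod A T'"
proof -
  from assms(4) obtain a where a: "a \<in> A" "p - a \<in> mpoly_space.span T"
    by (auto simp: span_mod_def)
  from a(2) have "h * (p - a) \<in> mpoly_space.span T'"
  proof (induction rule: mpoly_space.span_induct_alt)
    case base
    show ?case by (simp add: mpoly_space.span_zero)
  next
    case (step c t q)
    have "Poly_Mapping.single 0 c * (h * t) + h * q \<in> mpoly_space.span T'"
      by (rule mpoly_space.span_add[OF mpoly_space.span_scale[OF mpoly_space.span_base] step(2)])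
        (rule assms(3)[OF step(1)])
    then show ?case by (simp add: algebra_simps)
  qed
  then show ?thesis
    using mpoly_ideal_mult[OF assms(1) a(1) assms(2)]
    by (auto simp: span_mod_def right_diff_distrib)
qed

text \<open>The exponents of the parameters range over a box, not over a simplex, so that the number of
  these products is visibly at most a constant times \<open>(s + 1) ^ length \<theta>\<close>.\<close>

definition theta_monomials :: "'v set \<Rightarrow> ('v, 'a::field) mpoly list \<Rightarrow> nat \<Rightarrow> nat \<Rightarrow> ('v, 'a) mpoly set" where
  "theta_monomials V \<theta> D s =
     (\<lambda>(\<beta>, m). (\<Prod>j<length \<theta>. \<theta> ! j ^ \<beta> j) * Poly_Mapping.single m 1) `
       (({..<length \<theta>} \<rightarrow>\<^sub>E {..s}) \<times> {m. Poly_Mapping.keys m \<subseteq> V \<and> mdeg m < D})"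

text \<open>A quantitative form of the graded Nakayama lemma: \<open>K[V]/A\<close> is a finite module over
  \<open>K[\<theta>]\<close>, generated by the monomials of degree below \<open>D\<close>, and an element of degree \<open>d\<close> needs no
  exponent above \<open>d\<close>.\<close>

lemma homogeneous_in_span_mod:
  fixes A :: "('v, 'a::field) mpoly set"
  assumes A: "homogeneous_ideal V A" "ideal A (mpoly_ring V)"
    and \<theta>: "set \<theta> \<subseteq> polys V" "\<And>j. j < length \<theta> \<Longrightarrow> homogeneous (e j) (\<theta> ! j)"
      "\<And>j. j < length \<theta> \<Longrightarrow> e j > 0"
    and D: "\<And>m. Poly_Mapping.keys m \<subseteq> V \<Longrightarrow> mdeg m \<ge> D \<Longrightarrow>
      Poly_Mapping.single m 1 \<in> genideal (mpoly_ring V) (A \<union> set \<theta>)"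
    and "homogeneous d p" "p \<in> polys V" "d \<le> s"
  shows "p \<in> span_mod A (theta_monomials V \<theta> D s)"
  using assms(7-)
proof (induction d arbitrary: p s rule: less_induct)
  case (less d)
  let ?J = "genideal (mpoly_ring V) (A \<union> set \<theta>)"
  have J: "ideal ?J (mpoly_ring V)"
    using mpoly_idealD[OF A(2)] \<theta>(1) by (intro ideal_genideal_mpoly) blast
  note expand = sum_single_lookup[OF finite_keys subset_refl, of p]
  have keys: "Poly_Mapping.keys m \<subseteq> V" "mdeg m = d" if "m \<in> Poly_Mapping.keys p" for m
    using that less.prems by (auto simp: polys_iff homogeneous_def)
  have scale: "Poly_Mapping.single m c = Poly_Mapping.single 0 c * Poly_Mapping.single m 1" for m :: "'v \<Rightarrow>\<^sub>0 nat" and c :: 'a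
    by (simp add: mult_single)
  show ?case
  proof (cases "d < D")
    case True
    have "Poly_Mapping.single m (Poly_Mapping.lookup p m) \<in> mpoly_space.span (theta_monomials V \<theta> D s)"
      if m: "m \<in> Poly_Mapping.keys p" for m
    proof -
      let ?\<beta> = "\<lambda>j\<in>{..<length \<theta>}. 0 :: nat"
      have "(\<Prod>j<length \<theta>. \<theta> ! j ^ ?\<beta> j) = 1"
        by (intro prod.neutral) auto
      then have "(Poly_Mapping.single m 1 :: ('v, 'a) mpoly) = (case (?\<beta>, m) of (\<beta>, m) \<Rightarrow> (\<Prod>j<length \<theta>. \<theta> ! j ^ \<beta> j) * Poly_Mapping.single m 1)"
        by (simp only: prod.case mult_1_left)
      moreover have "(?\<beta>, m) \<in> ({..<length \<theta>} \<rightarrow>\<^sub>E {..s}) \<times> {m. Poly_Mapping.keys m \<subseteq> V \<and> mdeg m < D}"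
        using keys[OF m] True by auto
      ultimately have "Poly_Mapping.single m 1 \<in> theta_monomials V \<theta> D s"
        unfolding theta_monomials_def by (rule image_eqI)
      then show ?thesis
        by (subst scale) (intro mpoly_space.span_scale mpoly_space.span_base)
    qed
    then have "p \<in> mpoly_space.span (theta_monomials V \<theta> D s)"
      by (subst expand) (intro mpoly_space.span_sum)
    then show ?thesis
      using mpoly_idealD[OF A(2)] by (auto simp: span_mod_def intro!: bexI[of _ 0])
  next
    case False
    have "Poly_Mapping.single m (Poly_Mapping.lookup p m) \<in> ?J" if "m \<in> Poly_Mapping.keys p" for m
    proof (subst scale, rule mpoly_ideal_mult[OF J])
      show "Poly_Mapping.single m 1 \<in> ?J"
        using keys[OF that] False by (intro D) simp_all
    qed (simp add: polys_single)
    then have "(\<Sum>m\<in>Poly_Mapping.keys p. Poly_Mapping.single m (Poly_Mapping.lookup p m)) \<in> ?J"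
      by (rule mpoly_ideal_sum[OF J])
    then have "p \<in> ?J"
      unfolding expand[symmetric] .
    then obtain a g where a: "a \<in> A" and eq: "p = a + (\<Sum>j<length \<theta>. \<theta> ! j * g j)"
      and "\<forall>j. g j \<in> polys V \<and> (g j = 0 \<or> e j \<le> d \<and> homogeneous (d - e j) (g j))"
      using homogeneous_decomposition[where e = e, OF A(1) \<theta>(1,2) less.prems(1)] by blast
    then have g: "\<And>j. g j \<in> polys V" "\<And>j. g j = 0 \<or> e j \<le> d \<and> homogeneous (d - e j) (g j)"
      by simp_all
    have "\<theta> ! j * g j \<in> span_mod A (theta_monomials V \<theta> D s)" if j: "j < length \<theta>" for j
    proof (cases "g j = 0")
      case True
      then show ?thesis
        using span_mod_ideal[OF A(2)] mpoly_idealD[OF A(2)] by auto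
    next
      case False
      then have gj: "e j \<le> d" "homogeneous (d - e j) (g j)"
        using g(2) by blast+
      have lt: "d - e j < d" "d - e j \<le> s - 1" "s > 0"
        using gj(1) \<theta>(3)[OF j] less.prems(3) by linarith+
      have "g j \<in> span_mod A (theta_monomials V \<theta> D (s - 1))"
        by (rule less.IH[OF lt(1) gj(2) g(1) lt(2)])
      moreover have "\<theta> ! j * t \<in> theta_monomials V \<theta> D s" if t: "t \<in> theta_monomials V \<theta> D (s - 1)" for t
      proof -
        from t obtain \<beta> m where \<beta>: "\<beta> \<in> {..<length \<theta>} \<rightarrow>\<^sub>E {..s - 1}" "Poly_Mapping.keys m \<subseteq> V" "mdeg m < D"
          and t_eq: "t = (\<Prod>j<length \<theta>. \<theta> ! j ^ \<beta> j) * Poly_Mapping.single m 1"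
          by (auto simp: theta_monomials_def)
        let ?\<beta> = "\<beta>(j := Suc (\<beta> j))"
        have "\<beta> i \<le> s - 1" if "i < length \<theta>" for i
          using \<beta>(1) that by auto
        then have "?\<beta> \<in> {..<length \<theta>} \<rightarrow>\<^sub>E {..s}"
          using \<beta>(1) j lt(3) by (fastforce simp: PiE_iff extensional_def)
        moreover have "(\<Prod>i<length \<theta>. \<theta> ! i ^ ?\<beta> i) = \<theta> ! j * (\<Prod>i<length \<theta>. \<theta> ! i ^ \<beta> i)"
        proof -
          have "(\<Prod>i<length \<theta>. \<theta> ! i ^ ?\<beta> i) = (\<Prod>i<length \<theta>. (if i = j then \<theta> ! j else 1) * \<theta> ! i ^ \<beta> i)"
            by (intro prod.cong) auto
          then show ?thesis
            using j by (simp add: prod.distrib)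
        qed
        ultimately show ?thesis
          unfolding theta_monomials_def t_eq using \<beta>(2,3)
          by (intro image_eqI[of _ _ "(?\<beta>, m)"]) (auto simp: mult.assoc)
      qed
      ultimately show ?thesis
        using span_mod_mult[OF A(2)] \<theta>(1) j by (meson nth_mem subsetD)
    qed
    then show ?thesis
      unfolding eq by (intro span_mod_add[OF A(2)] span_mod_sum[OF A(2)] span_mod_ideal[OF A(2) a]) auto
  qed
qed

definition degree_le :: "nat \<Rightarrow> ('v, 'a::comm_ring_1) mpoly \<Rightarrow> bool" where
  "degree_le s p \<longleftrightarrow> (\<forall>m\<in>Poly_Mapping.keys p. mdeg m \<le> s)"

lemma degree_le_mult: "degree_le s p \<Longrightarrow> degree_le t q \<Longrightarrow> degree_le (s + t) (p * q)"
  using Poly_Mapping.keys_mult[of p q] by (fastforce simp: degree_le_def mdeg_add intro: add_mono)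

lemma degree_le_one: "degree_le s 1"
  by (simp add: degree_le_def mdeg_def)

lemma degree_le_mono: "degree_le s p \<Longrightarrow> s \<le> t \<Longrightarrow> degree_le t p"
  by (auto simp: degree_le_def)

lemma degree_le_power: "degree_le s p \<Longrightarrow> degree_le (n * s) (p ^ n)"
  by (induction n) (auto simp: degree_le_one intro: degree_le_mult)

lemma degree_le_prod:
  "finite I \<Longrightarrow> (\<And>i. i \<in> I \<Longrightarrow> degree_le s (f i)) \<Longrightarrow> degree_le (card I * s) (prod f I)"
  by (induction I rule: finite_induct) (auto simp: degree_le_one intro: degree_le_mult)

lemma degree_le_exists: "\<exists>s. degree_le s p"
  unfolding degree_le_def by (rule exI[of _ "\<Sum>m\<in>Poly_Mapping.keys p. mdeg m"]) (auto intro: member_le_sum)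

lemma card_theta_monomials:
  assumes "finite V"
  shows "finite (theta_monomials V \<theta> D s)"
    and "card (theta_monomials V \<theta> D s)
      \<le> Suc s ^ length \<theta> * card {m. Poly_Mapping.keys m \<subseteq> V \<and> mdeg m < D}"
proof -
  let ?M = "{m. Poly_Mapping.keys m \<subseteq> V \<and> mdeg m < D}"
  let ?P = "{..<length \<theta>} \<rightarrow>\<^sub>E {..s}"
  have fin: "finite (?P \<times> ?M)"
    using finite_monomials[OF assms] by (intro finite_SigmaI finite_PiE) auto
  then show "finite (theta_monomials V \<theta> D s)"
    unfolding theta_monomials_def by (rule finite_imageI)
  have "card (theta_monomials V \<theta> D s) \<le> card (?P \<times> ?M)"
    unfolding theta_monomials_def by (rule card_image_le[OF fin])
  also have "\<dots> = Suc s ^ length \<theta> * card ?M"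
    by (simp add: card_cartesian_product card_PiE)
  finally show "card (theta_monomials V \<theta> D s) \<le> Suc s ^ length \<theta> * card ?M" .
qed

text \<open>Let \<open>m\<close> be the number of parameters. In a chain of \<open>m + 2\<close> primes pick \<open>m + 1\<close> elements from its
  steps. Their power products with exponents at most \<open>t\<close> number \<open>(t + 1) ^ (m + 1)\<close>, but have degree
  \<open>O(t)\<close>, hence lie in a space of dimension \<open>O(t ^ m)\<close> modulo \<open>A\<close>. For large \<open>t\<close> they are linearly
  dependent modulo \<open>A\<close>, contrary to \<open>prime_chain_power_products_independent\<close>.\<close>

lemma krull_dim_le_length:
  fixes A :: "('v, 'a::field) mpoly set"
  assumes "finite V" and A: "homogeneous_ideal V A" "ideal A (mpoly_ring V)"
    and \<theta>: "set \<theta> \<subseteq> polys V" "\<And>j. j < length \<theta> \<Longrightarrow> homogeneous (e j) (\<theta> ! j)"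
      "\<And>j. j < length \<theta> \<Longrightarrow> e j > 0"
    and nil: "\<And>v. v \<in> V \<Longrightarrow> \<exists>n. mvar v ^ n \<in> genideal (mpoly_ring V) (A \<union> set \<theta>)"
  shows "krull_dim (mpoly_ring V Quot A) \<le> ereal (real (length \<theta>))"
proof -
  define m where "m = length \<theta>"
  have J: "ideal (genideal (mpoly_ring V) (A \<union> set \<theta>)) (mpoly_ring V)"
    using mpoly_idealD[OF A(2)] \<theta>(1) by (intro ideal_genideal_mpoly) blast
  obtain D where D: "\<And>m. Poly_Mapping.keys m \<subseteq> V \<Longrightarrow> mdeg m \<ge> D \<Longrightarrow>
      Poly_Mapping.single m 1 \<in> genideal (mpoly_ring V) (A \<union> set \<theta>)"
    using high_monomials_in_ideal[OF J assms(1) nil] by blast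
  have span: "p \<in> span_mod A (theta_monomials V \<theta> D s)" if p: "p \<in> polys V" "degree_le s p" for p s
  proof -
    have "Poly_Mapping.single k (Poly_Mapping.lookup p k) \<in> span_mod A (theta_monomials V \<theta> D s)"
      if "k \<in> Poly_Mapping.keys p" for k
      using that p
      by (intro homogeneous_in_span_mod[OF A \<theta> D homogeneous_single])
         (auto simp: polys_iff degree_le_def)
    then have "(\<Sum>k\<in>Poly_Mapping.keys p. Poly_Mapping.single k (Poly_Mapping.lookup p k))
        \<in> span_mod A (theta_monomials V \<theta> D s)"
      by (rule span_mod_sum[OF A(2)])
    then show ?thesis
      unfolding sum_single_lookup[OF finite_keys subset_refl, of p, symmetric] .
  qed
  have "False" if chain: "prime_chain (mpoly_ring V) l P" "A \<subseteq> P 0" and "m < l" for l P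
  proof -
    define n where "n = Suc m"
    have chain': "prime_chain (mpoly_ring V) n P"
      using chain(1) \<open>m < l\<close> by (auto simp: prime_chain_def n_def)
    have "\<exists>x. x \<in> P (Suc i) - P i" if "i < n" for i
      using chain' that by (auto simp: prime_chain_def)
    then obtain x where x: "\<And>i. i < n \<Longrightarrow> x i \<in> P (Suc i) - P i"
      by metis
    have x_polys: "x i \<in> polys V" if "i < n" for i
    proof -
      have "ideal (P (Suc i)) (mpoly_ring V)"
        using chain' that by (auto simp: prime_chain_def mpoly_prime_iff)
      then show ?thesis
        using x[OF that] mpoly_ideal_polys by blast
    qed
    have "\<forall>i. \<exists>d. degree_le d (x i)"
      using degree_le_exists by blast
    then obtain ds where ds: "\<And>i. degree_le (ds i) (x i)"
      by metis
    define \<delta> where "\<delta> = (\<Sum>i<n. ds i)"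
    have \<delta>: "degree_le \<delta> (x i)" if "i < n" for i
      using that member_le_sum[of i "{..<n}" ds] by (intro degree_le_mono[OF ds]) (simp add: \<delta>_def)
    define y where "y \<alpha> = (\<Prod>i\<in>{0..<n}. x i ^ \<alpha> i)" for \<alpha> :: "nat \<Rightarrow> nat"
    define M where "M = card {m. Poly_Mapping.keys m \<subseteq> V \<and> mdeg m < D}"
    \<comment> \<open>With \<open>s = n * (t * \<delta>)\<close> we have \<open>Suc s \<le> Suc (n * \<delta>) * Suc t\<close>, so at most \<open>t * Suc t ^ m\<close>
      products span, fewer than the \<open>Suc t ^ Suc m\<close> power products.\<close>
    define t where "t = Suc (n * \<delta>) ^ m * M"
    define s where "s = n * (t * \<delta>)"
    let ?I = "{..<n} \<rightarrow>\<^sub>E {..t}"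
    let ?T = "theta_monomials V \<theta> D s"
    have finI: "finite ?I"
      by (intro finite_PiE) auto
    have y_span: "y \<alpha> \<in> span_mod A ?T" if \<alpha>: "\<alpha> \<in> ?I" for \<alpha>
    proof (rule span)
      show "y \<alpha> \<in> polys V"
        unfolding y_def by (intro polys_prod polys_power x_polys) auto
      have "degree_le (t * \<delta>) (x i ^ \<alpha> i)" if "i \<in> {0..<n}" for i
      proof (rule degree_le_mono[OF degree_le_power[OF \<delta>]])
        have "\<alpha> i \<in> {..t}"
          using \<alpha> that by (intro PiE_mem[OF \<alpha>]) auto
        then show "\<alpha> i * \<delta> \<le> t * \<delta>" by simp
      qed (use that in auto)
      then have "degree_le (card {0..<n} * (t * \<delta>)) (y \<alpha>)"
        unfolding y_def by (intro degree_le_prod) auto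
      then show "degree_le s (y \<alpha>)"
        by (simp add: s_def)
    qed
    define reduces where "reduces \<alpha> a u \<longleftrightarrow>
        a \<in> A \<and> y \<alpha> - a = (\<Sum>v\<in>?T. Poly_Mapping.single 0 (u v) * v)" for \<alpha> a u
    have "\<exists>a u. reduces \<alpha> a u" if \<alpha>: "\<alpha> \<in> ?I" for \<alpha>
    proof -
      obtain a where a: "a \<in> A" "y \<alpha> - a \<in> mpoly_space.span ?T"
        using y_span[OF \<alpha>] by (auto simp: span_mod_def)
      from a(2) obtain u where "y \<alpha> - a = (\<Sum>v\<in>?T. Poly_Mapping.single 0 (u v) * v)"
        unfolding mpoly_space.span_finite[OF card_theta_monomials(1)[OF assms(1)]] by (rule rangeE)
      with a(1) show ?thesis
        unfolding reduces_def by blast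
    qed
    then obtain a u where "\<And>\<alpha>. \<alpha> \<in> ?I \<Longrightarrow> reduces \<alpha> (a \<alpha>) (u \<alpha>)"
      by metis
    then have a: "\<And>\<alpha>. \<alpha> \<in> ?I \<Longrightarrow> a \<alpha> \<in> A"
      and u: "\<And>\<alpha>. \<alpha> \<in> ?I \<Longrightarrow> y \<alpha> - a \<alpha> = (\<Sum>v\<in>?T. Poly_Mapping.single 0 (u \<alpha> v) * v)"
      by (auto simp: reduces_def)
    have card_I: "card ?I = Suc t ^ n"
      by (simp add: card_PiE)
    have "card ?T \<le> Suc s ^ m * M"
      unfolding m_def M_def by (rule card_theta_monomials(2)[OF assms(1)])
    also have "\<dots> \<le> (Suc (n * \<delta>) * Suc t) ^ m * M"
      by (intro mult_right_mono power_mono) (auto simp: s_def algebra_simps)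
    also have "\<dots> = Suc t ^ m * (Suc (n * \<delta>) ^ m * M)"
      by (simp only: power_mult_distrib mult_ac)
    also have "\<dots> = Suc t ^ m * t"
      by (simp only: t_def)
    also have "\<dots> < Suc t ^ n"
      unfolding n_def by simp
    finally have card_less: "card ?T < card ?I"
      by (simp add: card_I)
    obtain F b where F: "F \<subseteq> ?I" "card ?I \<le> card F + card ?T"
      and b: "\<forall>j\<in>F. b j j \<noteq> 0" "\<forall>j\<in>F. \<forall>v\<in>?T. (\<Sum>\<alpha>\<in>?I. u \<alpha> v * b j \<alpha>) = 0"
      using homogeneous_linear_system[of ?T ?I UNIV "\<lambda>v \<alpha>. u \<alpha> v", OF card_theta_monomials(1)[OF assms(1)] finI]
      by auto
    have "F \<noteq> {}"
      using F(2) card_less by auto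
    then obtain k where k: "k \<in> F" by blast
    \<comment> \<open>A nontrivial solution of the linear system expressing that the \<open>y \<alpha>\<close> cancel modulo \<open>A\<close>.\<close>
    define c where "c = b k"
    have "(\<Sum>\<alpha>\<in>?I. Poly_Mapping.single 0 (c \<alpha>) * (y \<alpha> - a \<alpha>))
        = (\<Sum>\<alpha>\<in>?I. \<Sum>v\<in>?T. Poly_Mapping.single 0 (u \<alpha> v * c \<alpha>) * v)"
    proof (intro sum.cong refl)
      fix \<alpha> assume \<alpha>: "\<alpha> \<in> ?I"
      have "Poly_Mapping.single 0 r * (Poly_Mapping.single 0 r' * v) = Poly_Mapping.single 0 (r' * r) * v"
        for r r' :: 'a and v :: "('v, 'a) mpoly"
        by (simp only: mult.assoc[symmetric] mult_single add_0 mult.commute[of r r'])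
      then show "Poly_Mapping.single 0 (c \<alpha>) * (y \<alpha> - a \<alpha>)
          = (\<Sum>v\<in>?T. Poly_Mapping.single 0 (u \<alpha> v * c \<alpha>) * v)"
        by (simp only: u[OF \<alpha>] sum_distrib_left)
    qed
    also have "\<dots> = (\<Sum>v\<in>?T. Poly_Mapping.single 0 (\<Sum>\<alpha>\<in>?I. u \<alpha> v * c \<alpha>) * v)"
    proof -
      have "Poly_Mapping.single (0 :: 'v \<Rightarrow>\<^sub>0 nat) (sum f S) = (\<Sum>i\<in>S. Poly_Mapping.single 0 (f i))"
        for f :: "(nat \<Rightarrow> nat) \<Rightarrow> 'a" and S
        by (induction S rule: infinite_finite_induct) (auto simp: single_add)
      then show ?thesis
        by (subst sum.swap) (simp only: sum_distrib_right)
    qed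
    also have "\<dots> = 0"
      using b(2) k by (simp add: c_def)
    finally have "(\<Sum>\<alpha>\<in>?I. Poly_Mapping.single 0 (c \<alpha>) * y \<alpha>)
        = (\<Sum>\<alpha>\<in>?I. Poly_Mapping.single 0 (c \<alpha>) * a \<alpha>)"
      by (simp add: right_diff_distrib sum_subtractf)
    also have "\<dots> \<in> A"
      by (intro mpoly_ideal_sum[OF A(2)] mpoly_ideal_mult[OF A(2)] a polys_single) auto
    finally have "(\<Sum>\<alpha>\<in>?I. Poly_Mapping.single 0 (c \<alpha>) * y \<alpha>) \<in> P 0"
      using chain(2) by blast
    moreover have "inj_on (\<lambda>\<alpha>. restrict \<alpha> {0..<n}) ?I"
      by (rule inj_onI) (metis PiE_restrict lessThan_atLeast0)
    ultimately have "\<forall>\<alpha>\<in>?I. c \<alpha> = 0"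
      using prime_chain_power_products_independent[OF chain' x _ finI, of 0 c]
      unfolding y_def by auto
    then show False
      using k b(1) F(1) by (auto simp: c_def)
  qed
  then have "l \<le> length \<theta>" if "prime_chain (mpoly_ring V) l P" "A \<subseteq> P 0" for l P
    using that by (metis m_def not_le)
  then show ?thesis
    unfolding krull_dim_prime_chain prime_chain_quot_iff[OF cring_mpoly_ring A(2)]
    by (intro SUP_least) auto
qed

section \<open>A criterion for systems of parameters\<close>

lemma subst_zero_homogeneous:
  assumes "homogeneous d p" "d > 0"
  shows "subst (\<lambda>_. 0) p = 0"
proof -
  have "monom_subst (\<lambda>_. 0) m = (0 :: ('c, 'b) mpoly)" if "m \<in> Poly_Mapping.keys p" for m
  proof -
    have "mdeg m > 0"
      using that assms by (auto simp: homogeneous_def)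
    then have "Poly_Mapping.keys m \<noteq> {}"
      by (intro notI) (simp add: mdeg_def)
    then obtain v where "v \<in> Poly_Mapping.keys m"
      by blast
    then show ?thesis
      unfolding monom_subst_def by (intro prod_zero) (auto simp: in_keys_iff zero_power)
  qed
  then show ?thesis
    by (simp add: subst_def)
qed

lemma minus_constant_term_in_ideal:
  assumes Q: "ideal Q (mpoly_ring V)" and vars: "\<And>v. v \<in> V \<Longrightarrow> mvar v \<in> Q" and p: "p \<in> polys V"
  shows "p - Poly_Mapping.single 0 (Poly_Mapping.lookup p 0) \<in> Q"
proof -
  let ?f = "\<lambda>m. Poly_Mapping.single m (Poly_Mapping.lookup p m)"
  have "p = (\<Sum>m\<in>insert 0 (Poly_Mapping.keys p). ?f m)"
    by (rule sum_single_lookup) auto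
  also have "\<dots> = ?f 0 + (\<Sum>m\<in>Poly_Mapping.keys p - {0}. ?f m)"
    by (simp add: sum.insert_remove)
  finally have "p - ?f 0 = (\<Sum>m\<in>Poly_Mapping.keys p - {0}. ?f m)"
    by (simp add: algebra_simps)
  also have "\<dots> \<in> Q"
  proof (rule mpoly_ideal_sum[OF Q])
    fix m assume m: "m \<in> Poly_Mapping.keys p - {0}"
    then obtain v where v: "v \<in> Poly_Mapping.keys m"
      by (metis Diff_iff all_not_in_conv insertCI keys_eq_empty)
    have keys: "Poly_Mapping.keys m \<subseteq> V"
      using m p by (auto simp: polys_iff)
    have "1 \<le> Poly_Mapping.lookup m v"
      using v by (simp add: in_keys_iff)
    moreover have "Poly_Mapping.single (m - Poly_Mapping.single v 1) (Poly_Mapping.lookup p m) \<in> polys V"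
      by (rule polys_single[OF order_trans[OF keys_minus_subset keys]])
    moreover have "mvar v \<in> Q"
      using v keys vars by blast
    ultimately show "?f m \<in> Q"
      using single_factor_variable[of 1 m v "Poly_Mapping.lookup p m"] mpoly_ideal_mult[OF Q]
      by simp
  qed
  finally show ?thesis .
qed

text \<open>A prime that contains \<open>A\<close> and \<open>T\<close> contains all variables, and an ideal that contains these strictly
  contains a nonzero constant. So the polynomials without constant term form the only prime above
  \<open>A\<close> and \<open>T\<close>.\<close>

lemma krull_dim_quot_parameters_eq_zero:
  fixes A :: "('v::linorder, 'a::field) mpoly set"
  assumes A: "ideal A (mpoly_ring V)" and \<theta>: "T \<subseteq> polys V"
    and const: "\<And>f. f \<in> A \<union> T \<Longrightarrow> subst (\<lambda>_. 0 :: ('v, 'a) mpoly) f = 0"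
    and nil: "\<And>v. v \<in> V \<Longrightarrow> \<exists>n. mvar v ^ n \<in> genideal (mpoly_ring V) (A \<union> T)"
  shows "krull_dim ((mpoly_ring V Quot A) Quot
    genideal (mpoly_ring V Quot A) ((+>\<^bsub>mpoly_ring V\<^esub>) A ` T)) = 0"
proof -
  let ?R = "mpoly_ring V" let ?B = "?R Quot A"
  let ?\<pi> = "(+>\<^bsub>?R\<^esub>) A"
  let ?J = "genideal ?B (?\<pi> ` T)"
  have B: "cring ?B"
    by (rule ideal.quotient_is_cring[OF A cring_mpoly_ring])
  have carr: "?\<pi> ` polys V = carrier ?B"
    using carrier_quot[of ?R A] by simp
  have sub: "?\<pi> ` T \<subseteq> carrier ?B"
    using \<theta> unfolding carr[symmetric] by blast
  have J: "ideal ?J ?B"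
    by (rule ring.genideal_ideal[OF cring.axioms(1)[OF B] sub])
  note chains = prime_chain_quot_iff[OF B J]
  have "l = 0" if "prime_chain ?B l P" "?J \<subseteq> P 0" for l P
  proof (rule ccontr)
    assume "l \<noteq> 0"
    define Q where "Q i = {r \<in> polys V. ?\<pi> r \<in> P i}" for i
    have Q: "prime_chain ?R l Q"
      unfolding Q_def
      by (rule prime_chain_vimage[OF ideal.rcos_ring_hom_ring[OF A] cring_mpoly_ring carr that(1)])
    then have Q0: "ideal (Q 0) ?R" "primeideal (Q 0) ?R"
      and Q1: "ideal (Q 1) ?R" "1 \<notin> Q 1" and lt: "Q 0 \<subset> Q 1"
      using \<open>l \<noteq> 0\<close> by (auto simp: prime_chain_def mpoly_prime_iff)
    have P0: "ideal (P 0) ?B"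
      using that(1) by (auto simp: prime_chain_def primeideal_def)
    have "T \<subseteq> Q 0"
      using ring.genideal_self[OF cring.axioms(1)[OF B] sub] that(2) \<theta> by (auto simp: Q_def)
    moreover have "A \<subseteq> Q 0"
    proof
      fix a assume a: "a \<in> A"
      have "\<zero>\<^bsub>?B\<^esub> \<in> P 0"
        by (rule additive_subgroup.zero_closed[OF ideal.axioms(1)[OF P0]])
      moreover have "?\<pi> a = A"
        using abelian_subgroup.a_rcos_const[OF abelian_subgroupI3[OF ideal.axioms(1)[OF A]] a]
          ring.is_abelian_group[OF cring.axioms(1)[OF cring_mpoly_ring]] by blast
      ultimately show "a \<in> Q 0"
        using mpoly_ideal_polys[OF A a] by (simp add: Q_def FactRing_def)
    qed
    ultimately have gen: "genideal ?R (A \<union> T) \<subseteq> Q 0"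
      by (intro genideal_mpoly_minimal Q0) auto
    have "mvar v \<in> Q 0" if v: "v \<in> V" for v
    proof -
      obtain n where "mvar v ^ n \<in> Q 0"
        using nil[OF v] gen by blast
      then show ?thesis
      proof (induction n)
        case 0
        then show ?case using Q0(2) by (simp add: mpoly_prime_iff)
      next
        case (Suc n)
        then show ?case
          using primeideal.I_prime[OF Q0(2), of "mvar v" "mvar v ^ n"] v by auto
      qed
    qed
    note vars = this
    obtain p where p: "p \<in> Q 1" "p \<notin> Q 0"
      using lt by blast
    define c where "c = Poly_Mapping.lookup p 0"
    have pc: "p - Poly_Mapping.single 0 c \<in> Q 0"
      unfolding c_def using mpoly_ideal_polys[OF Q1(1) p(1)]
      by (intro minus_constant_term_in_ideal[OF Q0(1) vars])
    then have "c \<noteq> 0"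
      using p(2) by auto
    have "Poly_Mapping.single 0 c \<in> Q 1"
      using mpoly_ideal_diff[OF Q1(1) p(1), of "p - Poly_Mapping.single 0 c"] pc lt by auto
    then have "Poly_Mapping.single 0 (inverse c) * Poly_Mapping.single 0 c \<in> Q 1"
      by (rule mpoly_ideal_mult[OF Q1(1)]) (simp add: polys_single)
    then show False
      using Q1(2) \<open>c \<noteq> 0\<close> by (simp add: mult_single)
  qed
  then have zero: "l = 0" if "\<exists>P. prime_chain (?B Quot ?J) l P" for l
    using that unfolding chains by blast
  define M where "M = {p \<in> polys V. subst (\<lambda>_. 0 :: ('v, 'a) mpoly) p = 0}"
  have M: "primeideal M ?R"
    unfolding M_def by (rule primeideal_subst_kernel)
  have sub_M: "A \<subseteq> M" "T \<subseteq> M"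
    using const \<theta> mpoly_ideal_polys[OF A] by (auto simp: M_def)
  have "primeideal (?\<pi> ` M) ?B"
    by (rule primeideal_quot_image[OF cring_mpoly_ring A M sub_M(1)])
  moreover from this have "?J \<subseteq> ?\<pi> ` M"
    using sub_M(2) by (intro ring.genideal_minimal[OF cring.axioms(1)[OF B]]) (auto simp: primeideal_def)
  ultimately have "\<exists>P. prime_chain (?B Quot ?J) 0 P"
    unfolding chains by (intro exI[of _ "\<lambda>_. ?\<pi> ` M"]) (simp add: prime_chain_def)
  with zero have "{l. \<exists>P. prime_chain (?B Quot ?J) l P} = {0}"
    by blast
  then show ?thesis
    by (simp add: krull_dim_prime_chain zero_ereal_def)
qed

text \<open>The upper and the lower bound meet when the number of parameters is at most the number of
  variables minus the number of generators.\<close>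

lemma hsopI_linear:
  fixes S :: "('v::linorder, 'a::field) mpoly set"
  assumes fin: "finite U" "finite W" "finite S" and disj: "U \<inter> W = {}"
    and lin: "\<And>f. f \<in> S \<Longrightarrow> linear_form U W f"
    and hom: "\<And>f. f \<in> S \<Longrightarrow> \<exists>d. homogeneous d f"
    and \<theta>: "\<And>t. t \<in> set \<theta> \<Longrightarrow> t \<in> polys (U \<union> W) \<and> (\<exists>d>0. homogeneous d t)"
    and len: "length \<theta> + card S \<le> card U + card W"
    and nil: "\<And>v. v \<in> U \<union> W \<Longrightarrow> \<exists>n. mvar v ^ n \<in> genideal (mpoly_ring (U \<union> W)) (S \<union> set \<theta>)"
  shows "hsop (U \<union> W) (genideal (mpoly_ring (U \<union> W)) S)
    (map (\<lambda>f. genideal (mpoly_ring (U \<union> W)) S +>\<^bsub>mpoly_ring (U \<union> W)\<^esub> f) \<theta>)"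
proof -
  let ?V = "U \<union> W" let ?R = "mpoly_ring (U \<union> W)" let ?A = "genideal (mpoly_ring (U \<union> W)) S"
  have S: "S \<subseteq> polys ?V"
    using lin linear_form_polys by blast
  have S0: "subst (\<lambda>_. 0 :: ('v, 'a) mpoly) f = 0" if "f \<in> S" for f
    using lin[OF that] by (auto simp: linear_form_def subst_sum)
  have A: "ideal ?A ?R"
    by (rule ideal_genideal_mpoly[OF S])
  have A_hom: "homogeneous_ideal ?V ?A"
    using S hom by (auto simp: homogeneous_ideal_def)
  have \<theta>_polys: "set \<theta> \<subseteq> polys ?V"
    using \<theta> by blast
  have "\<forall>j<length \<theta>. \<exists>d>0. homogeneous d (\<theta> ! j)"
    using \<theta> by simp
  then obtain e where e: "\<And>j. j < length \<theta> \<Longrightarrow> homogeneous (e j) (\<theta> ! j)" "\<And>j. j < length \<theta> \<Longrightarrow> e j > 0"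
    by metis
  have SA: "S \<subseteq> ?A"
    by (rule genideal_mpoly_superset[OF S])
  have "?A \<union> set \<theta> \<subseteq> polys ?V"
    using \<theta>_polys mpoly_ideal_polys[OF A] by blast
  then have "genideal ?R (S \<union> set \<theta>) \<subseteq> genideal ?R (?A \<union> set \<theta>)"
    using SA genideal_mpoly_superset by (intro genideal_mpoly_minimal ideal_genideal_mpoly) blast+
  then have nil': "\<exists>n. mvar v ^ n \<in> genideal ?R (?A \<union> set \<theta>)" if "v \<in> ?V" for v
    using nil[OF that] by blast
  have "?A \<subseteq> {p \<in> polys ?V. subst (\<lambda>_. 0 :: ('v, 'a) mpoly) p = 0}"
    using S S0 by (intro genideal_mpoly_minimal primeideal.axioms(1)[OF primeideal_subst_kernel]) auto
  then have const: "subst (\<lambda>_. 0 :: ('v, 'a) mpoly) f = 0" if "f \<in> ?A \<union> set \<theta>" for f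
    using that \<theta> subst_zero_homogeneous by blast
  have "krull_dim (?R Quot ?A) = ereal (real (length \<theta>))"
  proof (rule antisym)
    show "krull_dim (?R Quot ?A) \<le> ereal (real (length \<theta>))"
      using fin nil' by (intro krull_dim_le_length[OF _ A_hom A \<theta>_polys e]) auto
    show "ereal (real (length \<theta>)) \<le> krull_dim (?R Quot ?A)"
      by (rule krull_dim_linear_ge[OF fin disj lin len])
  qed
  moreover have "krull_dim ((?R Quot ?A) Quot genideal (?R Quot ?A) ((+>\<^bsub>?R\<^esub>) ?A ` set \<theta>)) = 0"
    by (rule krull_dim_quot_parameters_eq_zero[OF A \<theta>_polys const nil'])
  moreover have "\<exists>d>0. \<exists>f\<in>polys ?V. homogeneous d f \<and> q = ?A +>\<^bsub>?R\<^esub> f"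
    if "q \<in> set (map (\<lambda>f. ?A +>\<^bsub>?R\<^esub> f) \<theta>)" for q
    using that \<theta> by fastforce
  ultimately show ?thesis
    unfolding hsop_def using A_hom by simp
qed

section \<open>Radical membership\<close>

definition poly_radical :: "'v set \<Rightarrow> ('v, 'a::comm_ring_1) mpoly set \<Rightarrow> ('v, 'a) mpoly set" where
  "poly_radical V J = {p \<in> polys V. \<exists>n. p ^ n \<in> J}"

lemma poly_radical_superset: "ideal J (mpoly_ring V) \<Longrightarrow> p \<in> J \<Longrightarrow> p \<in> poly_radical V J"
  using mpoly_ideal_polys by (auto simp: poly_radical_def intro!: exI[of _ 1])

lemma poly_radical_power: "p \<in> polys V \<Longrightarrow> p ^ n \<in> poly_radical V J \<Longrightarrow> p \<in> poly_radical V J"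
  by (auto simp: poly_radical_def power_mult[symmetric])

lemma polys_of_nat [simp]: "of_nat n \<in> polys V"
  by (induction n) auto

lemma ideal_poly_radical:
  assumes J: "ideal J (mpoly_ring V)"
  shows "ideal (poly_radical V J) (mpoly_ring V)"
proof (unfold mpoly_ideal_iff, intro conjI ballI)
  show "poly_radical V J \<subseteq> polys V"
    by (auto simp: poly_radical_def)
  show "0 \<in> poly_radical V J"
    using mpoly_idealD[OF J] by (intro poly_radical_superset[OF J]) blast
  fix p q r assume p: "p \<in> poly_radical V J"
  then obtain m where m: "p \<in> polys V" "p ^ m \<in> J"
    by (auto simp: poly_radical_def)
  show "r * p \<in> poly_radical V J" if "r \<in> polys V"
    using m mpoly_ideal_mult[OF J m(2), of "r ^ m"] that
    by (auto simp: poly_radical_def power_mult_distrib)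
  assume "q \<in> poly_radical V J"
  then obtain n where n: "q \<in> polys V" "q ^ n \<in> J"
    by (auto simp: poly_radical_def)
  have "of_nat (m + n choose i) * p ^ i * q ^ (m + n - i) \<in> J" for i
  proof (cases "m \<le> i")
    case True
    then have "p ^ i = p ^ (i - m) * p ^ m"
      by (simp flip: power_add)
    then have "of_nat (m + n choose i) * p ^ i * q ^ (m + n - i)
        = (of_nat (m + n choose i) * p ^ (i - m) * q ^ (m + n - i)) * p ^ m"
      by (simp only: mult_ac)
    then show ?thesis
      using m n mpoly_ideal_mult[OF J m(2)] by simp
  next
    case False
    then have "m + n - i = (m - i) + n" by simp
    then have "of_nat (m + n choose i) * p ^ i * q ^ (m + n - i)
        = (of_nat (m + n choose i) * p ^ i * q ^ (m - i)) * q ^ n"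
      by (simp only: power_add mult.assoc)
    then show ?thesis
      using m n mpoly_ideal_mult[OF J n(2)] by simp
  qed
  then have "(p + q) ^ (m + n) \<in> J"
    unfolding binomial_ring by (intro mpoly_ideal_sum[OF J])
  then show "p + q \<in> poly_radical V J"
    using m n by (auto simp: poly_radical_def)
qed

lemma subst_congruence:
  assumes J: "ideal J (mpoly_ring V)" and \<sigma>: "\<And>v. v \<in> V \<Longrightarrow> mvar v - \<sigma> v \<in> J"
    and "p \<in> polys V"
  shows "p - subst \<sigma> p \<in> J"
proof -
  have \<sigma>_polys: "\<sigma> v \<in> polys V" if "v \<in> V" for v
    using polys_diff[OF polys_mvar[OF that] mpoly_ideal_polys[OF J \<sigma>[OF that]]] by simp
  have mult: "p * q - p' * q' \<in> J" if "p - p' \<in> J" "q - q' \<in> J" "q \<in> polys V" "p' \<in> polys V" for p p' q q'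
  proof -
    have "q * (p - p') + p' * (q - q') \<in> J"
      by (intro mpoly_ideal_add[OF J] mpoly_ideal_mult[OF J] that)
    then show ?thesis by (simp add: algebra_simps)
  qed
  have zero: "0 \<in> J"
    using mpoly_idealD[OF J] by blast
  have pow: "mvar v ^ n - \<sigma> v ^ n \<in> J" if "v \<in> V" for v n
  proof (induction n)
    case (Suc n)
    then show ?case
      using mult[OF \<sigma>[OF that] Suc] \<sigma>_polys that by simp
  qed (simp add: zero)
  have prod: "(\<Prod>v\<in>S. mvar v ^ f v) - (\<Prod>v\<in>S. \<sigma> v ^ f v) \<in> J" if "finite S" "S \<subseteq> V" for S and f :: "'a \<Rightarrow> nat"
    using that
  proof (induction S rule: finite_induct)
    case (insert v S)
    have "(\<Prod>v\<in>S. mvar v ^ f v) \<in> polys V"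
      using insert.prems by (intro polys_prod polys_power polys_mvar) auto
    then show ?case
      using insert mult[OF pow[of v "f v"] insert.IH] \<sigma>_polys by simp
  qed (simp add: zero)
  have "subst mvar p - subst \<sigma> p = (\<Sum>m\<in>Poly_Mapping.keys p.
      Poly_Mapping.single 0 (Poly_Mapping.lookup p m) * (monom_subst mvar m - monom_subst \<sigma> m))"
    by (simp add: subst_def right_diff_distrib sum_subtractf)
  also have "\<dots> \<in> J"
    using assms(3) by (intro mpoly_ideal_sum[OF J] mpoly_ideal_mult[OF J] polys_single)
      (auto simp: monom_subst_def polys_iff intro!: prod)
  finally show ?thesis
    by (simp add: subst_mvar_id)
qed

section \<open>The commutator\<close>

primrec var_code :: "var \<Rightarrow> nat" where
  "var_code (X i j) = prod_encode (0, prod_encode (i, j))"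
| "var_code (Y i j) = prod_encode (1, prod_encode (i, j))"

lemma inj_var_code: "var_code v = var_code w \<Longrightarrow> v = w"
  by (cases v; cases w) simp_all

text \<open>Some linear order on the variables is needed to see that \<open>K[X, Y]\<close> is a domain; any encoding
  into the natural numbers provides one.\<close>

instantiation var :: linorder
begin

definition less_eq_var :: "var \<Rightarrow> var \<Rightarrow> bool" where
  "v \<le> w \<longleftrightarrow> var_code v \<le> var_code w"

definition less_var :: "var \<Rightarrow> var \<Rightarrow> bool" where
  "v < w \<longleftrightarrow> var_code v < var_code w"

instance
  by standard (auto simp: less_eq_var_def less_var_def intro: inj_var_code)

end

definition x_vars :: "nat \<Rightarrow> var set" where
  "x_vars n = (\<lambda>(i, j). X i j) ` ({1..n} \<times> {1..n})"

definition y_vars :: "nat \<Rightarrow> var set" where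
  "y_vars n = (\<lambda>(i, j). Y i j) ` ({1..n} \<times> {1..n})"

lemma mat_vars_eq: "mat_vars n = x_vars n \<union> y_vars n"
  by (auto simp: mat_vars_def x_vars_def y_vars_def)

lemma X_in_mat_vars [simp]: "X i j \<in> mat_vars n \<longleftrightarrow> i \<in> {1..n} \<and> j \<in> {1..n}"
  and Y_in_mat_vars [simp]: "Y i j \<in> mat_vars n \<longleftrightarrow> i \<in> {1..n} \<and> j \<in> {1..n}"
  by (auto simp: mat_vars_def)

lemma X_in_x_vars: "X i j \<in> x_vars n \<longleftrightarrow> i \<in> {1..n} \<and> j \<in> {1..n}"
  and Y_in_y_vars: "Y i j \<in> y_vars n \<longleftrightarrow> i \<in> {1..n} \<and> j \<in> {1..n}"
  by (auto simp: x_vars_def y_vars_def)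

lemma finite_x_vars: "finite (x_vars n)" and finite_y_vars: "finite (y_vars n)"
  by (auto simp: x_vars_def y_vars_def)

lemma card_x_vars: "card (x_vars n) = n * n" and card_y_vars: "card (y_vars n) = n * n"
  unfolding x_vars_def y_vars_def
  by (subst card_image; auto simp: inj_on_def card_cartesian_product)+

lemma x_y_vars_disjoint: "x_vars n \<inter> y_vars n = {}"
  by (auto simp: x_vars_def y_vars_def)

lemma comm_entry_linear:
  assumes "i \<in> {1..n}" "j \<in> {1..n}"
  shows "linear_form (x_vars n) (y_vars n) (comm_entry n i j)"
proof -
  have x: "xvar a b \<in> polys (x_vars n)" and y: "Y a b \<in> y_vars n"
    if "a \<in> {1..n}" "b \<in> {1..n}" for a b
    using that by (simp_all add: X_in_x_vars Y_in_y_vars)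
  show ?thesis
    unfolding comm_entry_def using assms x y
    by (intro linear_form_diff linear_form_sum)
      (auto intro!: linear_form_term finite_y_vars simp: mult.commute[of "mvar (Y _ _)"])
qed

lemma homogeneous_comm_entry: "homogeneous 2 (comm_entry n i j)"
  unfolding comm_entry_def
  using homogeneous_mult[OF homogeneous_mvar homogeneous_mvar]
  by (intro homogeneous_diff homogeneous_sum) (simp_all add: numeral_2_eq_2)

lemma comm_entry_polys:
  assumes "i \<in> {1..n}" "j \<in> {1..n}"
  shows "comm_entry n i j \<in> polys (mat_vars n)"
  unfolding comm_entry_def using assms
  by (intro polys_diff polys_sum polys_mult polys_mvar) auto

lemma trace_comm_entry: "(\<Sum>i\<in>{1..n}. comm_entry n i i) = (0 :: (var, 'a::comm_ring_1) mpoly)"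
proof -
  have "(\<Sum>i\<in>{1..n}. \<Sum>l\<in>{1..n}. yvar i l * xvar l i)
      = (\<Sum>l\<in>{1..n}. \<Sum>i\<in>{1..n}. xvar l i * yvar i l :: (var, 'a) mpoly)"
    by (subst sum.swap) (simp add: mult.commute)
  then show ?thesis
    by (simp add: comm_entry_def sum_subtractf)
qed

text \<open>Two of the \<open>2n\<close> listed entries of \<open>C\<close> are left out: the entry in the centre occurs on both diagonals,
  and \<open>c\<^sub>1\<^sub>1\<close> is minus the sum of the other diagonal entries. With all of them the count of
  generators would be too large for the lower bound on the dimension.\<close>

definition comm_generators :: "nat \<Rightarrow> (var, 'a::comm_ring_1) mpoly set" where
  "comm_generators k = (\<lambda>i. comm_entry (2 * k + 1) i i) ` {2..2 * k + 1} \<union>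
     (\<lambda>i. comm_entry (2 * k + 1) i (2 * k + 2 - i)) ` ({1..2 * k + 1} - {k + 1})"

lemma card_comm_generators: "card (comm_generators k) \<le> 4 * k"
proof -
  have "card (comm_generators k :: (var, 'a) mpoly set)
      \<le> card {2..2 * k + 1} + card ({1..2 * k + 1} - {k + 1})"
    unfolding comm_generators_def
    by (rule order_trans[OF card_Un_le]) (intro add_mono card_image_le; simp)
  then show ?thesis by simp
qed

lemma diag_antidiag_ideal_eq:
  assumes "k \<ge> 1"
  shows "diag_antidiag_ideal (2 * k + 1) = genideal (mpoly_ring (mat_vars (2 * k + 1))) (comm_generators k)"
proof -
  let ?n = "2 * k + 1"
  let ?G = "{comm_entry ?n i i | i. i \<in> {1..?n}} \<union> {comm_entry ?n i (?n + 1 - i) | i. i \<in> {1..?n}}"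
  let ?S = "comm_generators k"
  let ?A = "genideal (mpoly_ring (mat_vars ?n)) ?S"
  have G: "?G \<subseteq> polys (mat_vars ?n)"
    by (auto intro!: comm_entry_polys)
  have SG: "?S \<subseteq> ?G"
    by (auto simp: comm_generators_def)
  then have S: "?S \<subseteq> polys (mat_vars ?n)"
    using G by blast
  note A = ideal_genideal_mpoly[OF S] and SA = genideal_mpoly_superset[OF S]
  have diag: "comm_entry ?n i i \<in> ?A" if "i \<in> {1..?n}" for i
  proof (cases "i = 1")
    case True
    have "{1..?n} - {1} = {2..?n}" by auto
    then have "(\<Sum>i\<in>{1..?n}. comm_entry ?n i i) = comm_entry ?n 1 1 + (\<Sum>i\<in>{2..?n}. comm_entry ?n i i)"
      by (subst sum.remove[of _ 1]) auto
    then have "comm_entry ?n 1 1 + (\<Sum>i\<in>{2..?n}. comm_entry ?n i i) = 0"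
      unfolding trace_comm_entry by (rule sym)
    then have "comm_entry ?n 1 1 = 0 - (\<Sum>i\<in>{2..?n}. comm_entry ?n i i)"
      by (simp only: diff_0 eq_neg_iff_add_eq_0)
    also have "\<dots> \<in> ?A"
      using SA mpoly_idealD[OF A]
      by (intro mpoly_ideal_diff[OF A] mpoly_ideal_sum[OF A]) (auto simp: comm_generators_def)
    finally show ?thesis using True by simp
  next
    case False
    then show ?thesis
      using that SA by (auto simp: comm_generators_def)
  qed
  have "comm_entry ?n i (?n + 1 - i) \<in> ?A" if "i \<in> {1..?n}" for i
  proof (cases "i = k + 1")
    case True
    then have "?n + 1 - i = i" by simp
    then show ?thesis using diag[OF that] by simp
  next
    case False
    then show ?thesis
      using that SA by (auto simp: comm_generators_def)
  qed
  with diag have "?G \<subseteq> ?A" by auto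
  then show ?thesis
    unfolding diag_antidiag_ideal_def
    by (intro antisym genideal_mpoly_minimal A ideal_genideal_mpoly G
        order_trans[OF SG genideal_mpoly_superset[OF G]])
qed

lemma card_Lambda:
  assumes "k \<ge> 1"
  shows "card (Lambda k) = 4 * k * k + 1"
proof -
  let ?n = "2 * k + 1"
  have eq: "Lambda k = ({1..k} \<times> {1..?n} \<union> {(k + 1, k + 1)}) \<union>
      ({k + 2..?n} \<times> {k + 2..?n} \<union> {k + 3..?n} \<times> {1..k})"
  proof -
    have "{(i, j). 1 \<le> i \<and> i \<le> k \<and> 1 \<le> j \<and> j \<le> ?n} = {1..k} \<times> {1..?n}"
      "{(i, j). k + 2 \<le> i \<and> i \<le> ?n \<and> k + 2 \<le> j \<and> j \<le> ?n} = {k + 2..?n} \<times> {k + 2..?n}"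
      "{(i, j). k + 3 \<le> i \<and> i \<le> ?n \<and> 1 \<le> j \<and> j \<le> k} = {k + 3..?n} \<times> {1..k}"
      by auto
    then show ?thesis
      by (simp only: Lambda_def Un_assoc)
  qed
  have "card (Lambda k) = card ({1..k} \<times> {1..?n} \<union> {(k + 1, k + 1)})
      + card ({k + 2..?n} \<times> {k + 2..?n} \<union> {k + 3..?n} \<times> {1..k})"
    unfolding eq by (rule card_Un_disjoint) auto
  also have "card ({1..k} \<times> {1..?n} \<union> {(k + 1, k + 1)}) = k * ?n + 1"
    by (subst card_Un_disjoint) (auto simp: card_cartesian_product)
  also have "card ({k + 2..?n} \<times> {k + 2..?n} \<union> {k + 3..?n} \<times> {1..k}) = k * k + (k - 1) * k"
    by (subst card_Un_disjoint) (auto simp: card_cartesian_product)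
  finally show ?thesis
    using assms by (cases k) (auto simp: algebra_simps)
qed

section \<open>The parameters\<close>

lemma Lambda_bounds:
  assumes "(i, j) \<in> Lambda k"
  shows "i \<in> {1..2 * k + 1}" "j \<in> {1..2 * k + 1}"
  using assms unfolding Lambda_def by auto

lemma Lambda_eq: "{(i, j). i \<in> {1..<2 * k + 2} \<and> j \<in> {1..<2 * k + 2} \<and> (i, j) \<in> Lambda k} = Lambda k"
  using Lambda_bounds by fastforce

lemma set_index_list:
  fixes P :: "nat \<Rightarrow> nat \<Rightarrow> bool"
  shows "set [f i j. i \<leftarrow> [a..<b], j \<leftarrow> [a..<b], P i j]
    = (\<lambda>(i, j). f i j) ` {(i, j). i \<in> {a..<b} \<and> j \<in> {a..<b} \<and> P i j}"
  by (auto simp del: upt_Suc) force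

lemma set_guarded_list:
  fixes P :: "nat \<Rightarrow> bool"
  shows "set [f s. s \<leftarrow> [a..<b], P s] = f ` {s \<in> {a..<b}. P s}"
  by (auto simp del: upt_Suc)

lemma length_guarded_list:
  fixes P :: "nat \<Rightarrow> bool"
  shows "length [f s. s \<leftarrow> [a..<b], P s] = card {s \<in> {a..<b}. P s}"
proof -
  have "length [f s. s \<leftarrow> xs, P s] = length (filter P xs)" for xs
    by (induction xs) auto
  then show ?thesis
    by (simp add: distinct_length_filter Int_def conj_commute del: upt_Suc)
qed

lemma length_index_list:
  fixes P :: "nat \<Rightarrow> nat \<Rightarrow> bool"
  shows "length [f i j. i \<leftarrow> [a..<b], j \<leftarrow> [a..<b], P i j]
    = card {(i, j). i \<in> {a..<b} \<and> j \<in> {a..<b} \<and> P i j}"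
proof -
  have "length [f i j. i \<leftarrow> xs, j \<leftarrow> [a..<b], P i j] = (\<Sum>i\<leftarrow>xs. card {j \<in> {a..<b}. P i j})" for xs
    by (induction xs) (simp_all add: length_guarded_list del: upt_Suc)
  then have "length [f i j. i \<leftarrow> [a..<b], j \<leftarrow> [a..<b], P i j] = (\<Sum>i\<in>{a..<b}. card {j \<in> {a..<b}. P i j})"
    by (simp only: interv_sum_list_conv_sum_set_nat set_upt)
  also have "\<dots> = card (SIGMA i:{a..<b}. {j \<in> {a..<b}. P i j})"
    by (rule card_SigmaI[symmetric]) auto
  also have "(SIGMA i:{a..<b}. {j \<in> {a..<b}. P i j}) = {(i, j). i \<in> {a..<b} \<and> j \<in> {a..<b} \<and> P i j}"
    by auto
  finally show ?thesis .
qed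

lemma length_parameters:
  assumes "k \<ge> 1"
  shows "length (parameters k) = 8 * k * k + 4 * k + 2"
proof -
  have "{s \<in> {1..<2 * k + 2}. s \<noteq> k + 1} = {1..<2 * k + 2} - {k + 1}"
    by auto
  then have "card {s \<in> {1..<2 * k + 2}. s \<noteq> k + 1} = 2 * k"
    by simp
  then show ?thesis
    unfolding parameters_def length_append length_index_list Lambda_eq card_Lambda[OF assms]
      length_guarded_list length_map length_upt
    by simp
qed

lemma set_parameters:
  "set (parameters k) = (\<lambda>(i, j). xvar i j) ` Lambda k \<union> (\<lambda>(i, j). yvar j i) ` Lambda k \<union>
     (\<lambda>s. xvar (k + 1) s - yvar (2 * k + 2 - s) (k + 1)) ` ({1..2 * k + 1} - {k + 1}) \<union>
     (\<lambda>s. xvar s (k + 1) - yvar (k + 1) s) ` {k + 2..2 * k + 1} \<union>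
     (\<lambda>s. xvar (k + 2) s - yvar s (k + 2)) ` {1..k}"
proof -
  have "{s \<in> {1..<2 * k + 2}. s \<noteq> k + 1} = {1..2 * k + 1} - {k + 1}"
    and "{k + 2..<2 * k + 2} = {k + 2..2 * k + 1}" and "{1..<k + 1} = {1..k}"
    by auto
  then show ?thesis
    unfolding parameters_def set_append set_index_list Lambda_eq set_guarded_list set_map set_upt
    by (simp only: Un_assoc)
qed

section \<open>The commutator modulo the parameters\<close>

text \<open>The entries of \<open>X\<close> and \<open>Y\<close> after the parameters are set to zero. In \<open>X\<close> there remain row \<open>k + 1\<close>
  without its central entry, column \<open>k + 1\<close> below the centre, and the first \<open>k\<close> entries of row
  \<open>k + 2\<close>; the entries of \<open>Y\<close> are expressed through these.\<close>

definition reduced_x :: "nat \<Rightarrow> nat \<Rightarrow> nat \<Rightarrow> (var, 'a::comm_ring_1) mpoly" where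
  "reduced_x k i j =
     (if i = k + 1 \<and> j \<noteq> k + 1 \<or> i \<ge> k + 2 \<and> j = k + 1 \<or> i = k + 2 \<and> j \<le> k then xvar i j else 0)"

definition reduced_y :: "nat \<Rightarrow> nat \<Rightarrow> nat \<Rightarrow> (var, 'a::comm_ring_1) mpoly" where
  "reduced_y k i j =
     (if j = k + 1 \<and> i \<noteq> k + 1 then xvar (k + 1) (2 * k + 2 - i)
      else if i = k + 1 \<and> j \<ge> k + 2 then xvar j (k + 1)
      else if j = k + 2 \<and> i \<le> k then xvar (k + 2) i
      else 0)"

primrec reduce_var :: "nat \<Rightarrow> var \<Rightarrow> (var, 'a::comm_ring_1) mpoly" where
  "reduce_var k (X i j) = reduced_x k i j"
| "reduce_var k (Y i j) = reduced_y k i j"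

lemma reduce_var_congruent:
  fixes J :: "(var, 'a::comm_ring_1) mpoly set"
  assumes J: "ideal J (mpoly_ring V)" "set (parameters k) \<subseteq> J"
    and v: "v \<in> mat_vars (2 * k + 1)"
  shows "mvar v - reduce_var k v \<in> J"
proof -
  have zero: "0 \<in> J"
    using mpoly_idealD[OF J(1)] by blast
  have neg: "q - p \<in> J" if "p - q \<in> J" for p q
    using mpoly_ideal_diff[OF J(1) zero that] by simp
  note par = J(2)[unfolded set_parameters]
  show ?thesis
  proof (cases v)
    case (X i j)
    consider "reduced_x k i j = (xvar i j :: (var, 'a) mpoly)"
      | "(i, j) \<in> Lambda k" "reduced_x k i j = (0 :: (var, 'a) mpoly)"
    proof (cases "i = k + 1 \<and> j \<noteq> k + 1 \<or> i \<ge> k + 2 \<and> j = k + 1 \<or> i = k + 2 \<and> j \<le> k")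
      case False
      then have "(i, j) \<in> Lambda k"
        using v X by (simp add: Lambda_def) linarith
      moreover have "reduced_x k i j = (0 :: (var, 'a) mpoly)"
        unfolding reduced_x_def by (rule if_not_P[OF False])
      ultimately show ?thesis by (rule that(2))
    qed (auto simp: reduced_x_def)
    then show ?thesis
    proof cases
      case 2
      then have "xvar i j \<in> J"
        using par by blast
      with 2 X show ?thesis by simp
    qed (use zero X in simp)
  next
    case (Y i j)
    have rest: "(j, i) \<in> Lambda k" "reduced_y k i j = (0 :: (var, 'a) mpoly)"
      if not: "\<not> (j = k + 1 \<and> i \<noteq> k + 1)" "\<not> (i = k + 1 \<and> j \<ge> k + 2)" "\<not> (j = k + 2 \<and> i \<le> k)"
    proof -
      show "(j, i) \<in> Lambda k"
        using v Y not by (simp add: Lambda_def) linarith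
      show "reduced_y k i j = (0 :: (var, 'a) mpoly)"
        unfolding reduced_y_def if_not_P[OF not(1)] if_not_P[OF not(2)] if_not_P[OF not(3)] ..
    qed
    consider "j = k + 1 \<and> i \<noteq> k + 1" | "i = k + 1 \<and> j \<ge> k + 2" | "j = k + 2 \<and> i \<le> k"
      | "(j, i) \<in> Lambda k" "reduced_y k i j = (0 :: (var, 'a) mpoly)"
      using rest by blast
    then show ?thesis
    proof cases
      case 1
      have "xvar (k + 1) s - yvar (2 * k + 2 - s) (k + 1) \<in> J" if "s \<in> {1..2 * k + 1} - {k + 1}" for s
        using par that by blast
      moreover have "2 * k + 2 - i \<in> {1..2 * k + 1} - {k + 1}"
        using 1 v Y by auto
      moreover have "2 * k + 2 - (2 * k + 2 - i) = i"
        using v Y by auto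
      ultimately have "xvar (k + 1) (2 * k + 2 - i) - yvar i (k + 1) \<in> J"
        by metis
      then show ?thesis
        using 1 Y by (simp add: reduced_y_def neg)
    next
      case 2
      then have "xvar j (k + 1) - yvar (k + 1) j \<in> J"
        using par v Y by auto
      then show ?thesis
        using 2 Y by (simp add: reduced_y_def neg)
    next
      case 3
      then have "xvar (k + 2) i - yvar i (k + 2) \<in> J"
        using par v Y by auto
      then show ?thesis
        using 3 Y by (simp add: reduced_y_def neg)
    next
      case 4
      then have "yvar i j \<in> J"
        using par by blast
      with 4 Y show ?thesis by simp
    qed
  qed
qed

lemma subst_comm_entry:
  "subst (reduce_var k) (comm_entry n i j)
    = (\<Sum>l\<in>{1..n}. reduced_x k i l * reduced_y k l j) - (\<Sum>l\<in>{1..n}. reduced_y k i l * reduced_x k l j)"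
  by (simp add: comm_entry_def subst_sum)

lemma sum_eq_on_support:
  assumes "finite S" "T \<subseteq> S" "\<And>i. i \<in> S - T \<Longrightarrow> f i = 0"
  shows "sum f S = sum f T"
  using assms by (intro sum.mono_neutral_right) auto

text \<open>Nothing comes from \<open>XY\<close>: the upper rows of the reduced \<open>X\<close> and the left columns of the reduced
  \<open>Y\<close> vanish. In \<open>YX\<close> only column \<open>k + 1\<close> of \<open>Y\<close> meets row \<open>k + 1\<close> of \<open>X\<close>, and the identification
  of the former with the reversed latter turns the product into a square.\<close>

lemma reduced_antidiagonal:
  assumes "i \<in> {1..2 * k + 1}" "i \<noteq> k + 1"
  shows "subst (reduce_var k) (comm_entry (2 * k + 1) i (2 * k + 2 - i)) = - ((xvar (k + 1) (2 * k + 2 - i))\<^sup>2)"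
proof -
  have 1: "(\<Sum>l\<in>{1..2 * k + 1}. reduced_x k i l * reduced_y k l (2 * k + 2 - i)) = (\<Sum>l\<in>{}. reduced_x k i l * reduced_y k l (2 * k + 2 - i))"
    using assms by (intro sum_eq_on_support) (auto simp: reduced_x_def reduced_y_def)
  have 2: "(\<Sum>l\<in>{1..2 * k + 1}. reduced_y k i l * reduced_x k l (2 * k + 2 - i)) = (\<Sum>l\<in>{k + 1}. reduced_y k i l * reduced_x k l (2 * k + 2 - i))"
    using assms by (intro sum_eq_on_support) (auto simp: reduced_x_def reduced_y_def)
  show ?thesis
    unfolding subst_comm_entry 1 2 using assms
    by (auto simp: reduced_x_def reduced_y_def power2_eq_square)
qed

lemma reduced_diagonal_upper:
  assumes "i \<in> {1..k}"
  shows "subst (reduce_var k) (comm_entry (2 * k + 1) i i)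
    = - (xvar (k + 1) (2 * k + 2 - i) * xvar (k + 1) i) - (xvar (k + 2) i)\<^sup>2"
proof -
  have 1: "(\<Sum>l\<in>{1..2 * k + 1}. reduced_x k i l * reduced_y k l i) = (\<Sum>l\<in>{}. reduced_x k i l * reduced_y k l i)"
    using assms by (intro sum_eq_on_support) (auto simp: reduced_x_def)
  have 2: "(\<Sum>l\<in>{1..2 * k + 1}. reduced_y k i l * reduced_x k l i) = (\<Sum>l\<in>{k + 1, k + 2}. reduced_y k i l * reduced_x k l i)"
    using assms by (intro sum_eq_on_support) (auto simp: reduced_x_def reduced_y_def)
  show ?thesis
    unfolding subst_comm_entry 1 2 using assms
    by (simp add: reduced_x_def reduced_y_def power2_eq_square)
qed

lemma reduced_diagonal_lower:
  assumes "i \<in> {k + 3..2 * k + 1}"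
  shows "subst (reduce_var k) (comm_entry (2 * k + 1) i i)
    = (xvar i (k + 1))\<^sup>2 - xvar (k + 1) (2 * k + 2 - i) * xvar (k + 1) i"
proof -
  have 1: "(\<Sum>l\<in>{1..2 * k + 1}. reduced_x k i l * reduced_y k l i) = (\<Sum>l\<in>{k + 1}. reduced_x k i l * reduced_y k l i)"
    using assms by (intro sum_eq_on_support) (auto simp: reduced_x_def)
  have 2: "(\<Sum>l\<in>{1..2 * k + 1}. reduced_y k i l * reduced_x k l i) = (\<Sum>l\<in>{k + 1}. reduced_y k i l * reduced_x k l i)"
    using assms by (intro sum_eq_on_support) (auto simp: reduced_x_def reduced_y_def)
  show ?thesis
    unfolding subst_comm_entry 1 2 using assms
    by (simp add: reduced_x_def reduced_y_def power2_eq_square)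
qed

lemma reduced_diagonal_middle:
  assumes "k \<ge> 1"
  shows "subst (reduce_var k) (comm_entry (2 * k + 1) (k + 2) (k + 2))
    = (\<Sum>l\<in>{1..k}. (xvar (k + 2) l)\<^sup>2) + (xvar (k + 2) (k + 1))\<^sup>2 - xvar (k + 1) k * xvar (k + 1) (k + 2)"
proof -
  have "(\<Sum>l\<in>{1..2 * k + 1}. reduced_x k (k + 2) l * reduced_y k l (k + 2))
      = (\<Sum>l\<in>insert (k + 1) {1..k}. reduced_x k (k + 2) l * reduced_y k l (k + 2))"
    using assms by (intro sum_eq_on_support) (auto simp: reduced_x_def)
  also have "\<dots> = (xvar (k + 2) (k + 1))\<^sup>2 + (\<Sum>l\<in>{1..k}. (xvar (k + 2) l)\<^sup>2)"
    by (subst sum.insert) (auto simp: reduced_x_def reduced_y_def power2_eq_square intro!: sum.cong)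
  finally have 1: "(\<Sum>l\<in>{1..2 * k + 1}. reduced_x k (k + 2) l * reduced_y k l (k + 2))
      = (xvar (k + 2) (k + 1))\<^sup>2 + (\<Sum>l\<in>{1..k}. (xvar (k + 2) l)\<^sup>2)" .
  have 2: "(\<Sum>l\<in>{1..2 * k + 1}. reduced_y k (k + 2) l * reduced_x k l (k + 2))
      = (\<Sum>l\<in>{k + 1}. reduced_y k (k + 2) l * reduced_x k l (k + 2))"
    using assms by (intro sum_eq_on_support) (auto simp: reduced_x_def reduced_y_def)
  show ?thesis
    unfolding subst_comm_entry 1 2 using assms
    by (simp add: reduced_x_def reduced_y_def)
qed

text \<open>The squares on the anti-diagonal give row \<open>k + 1\<close> of \<open>X\<close>. Outside the centre, each diagonal entry contains a
  product of two of these; what is left is the square of an entry of row \<open>k + 2\<close> (rows \<open>1, \<dots>, k\<close>) or of column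
  \<open>k + 1\<close> (rows from \<open>k + 3\<close> on). The entry at \<open>k + 2\<close> comes last, because its sum of squares
  leaves one unknown summand only when the others are known.\<close>

lemma variables_in_radical:
  fixes J :: "(var, 'a::comm_ring_1) mpoly set"
  assumes "k \<ge> 1" and J: "ideal J (mpoly_ring (mat_vars (2 * k + 1)))"
    and par: "set (parameters k) \<subseteq> J"
    and diag: "\<And>i. i \<in> {1..2 * k + 1} \<Longrightarrow> comm_entry (2 * k + 1) i i \<in> J"
    and anti: "\<And>i. i \<in> {1..2 * k + 1} \<Longrightarrow> comm_entry (2 * k + 1) i (2 * k + 2 - i) \<in> J"
    and v: "v \<in> mat_vars (2 * k + 1)"
  shows "mvar v \<in> poly_radical (mat_vars (2 * k + 1)) J"
proof -
  let ?n = "2 * k + 1" let ?V = "mat_vars ?n" let ?rad = "poly_radical ?V J"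
  note rad = ideal_poly_radical[OF J]
  note add = mpoly_ideal_add[OF rad] and diff = mpoly_ideal_diff[OF rad] and mult = mpoly_ideal_mult[OF rad]
  have reduced: "subst (reduce_var k) p \<in> ?rad" if "p \<in> J" for p
  proof -
    have "p - (p - subst (reduce_var k) p) \<in> J"
      by (intro mpoly_ideal_diff[OF J] that subst_congruence[OF J] reduce_var_congruent[OF J par]
          mpoly_ideal_polys[OF J that])
    then show ?thesis
      by (intro poly_radical_superset[OF J]) simp
  qed
  have root: "xvar i j \<in> ?rad" if "(xvar i j)\<^sup>2 \<in> ?rad" "i \<in> {1..?n}" "j \<in> {1..?n}" for i j
    using poly_radical_power[OF _ that(1)] that(2,3) by simp
  have zero: "0 \<in> ?rad"
    using mpoly_idealD[OF rad] by blast
  have row: "xvar (k + 1) s \<in> ?rad" if s: "s \<in> {1..?n}" "s \<noteq> k + 1" for s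
  proof (rule root)
    have i: "2 * k + 2 - s \<in> {1..?n}" "2 * k + 2 - s \<noteq> k + 1" "2 * k + 2 - (2 * k + 2 - s) = s"
      using s by auto
    have "- ((xvar (k + 1) s)\<^sup>2) \<in> ?rad"
      using reduced[OF anti[OF i(1)]] unfolding reduced_antidiagonal[OF i(1,2)] unfolding i(3) .
    from diff[OF zero this] show "(xvar (k + 1) s)\<^sup>2 \<in> ?rad" by simp
  qed (use s in auto)
  have row_mult: "p * xvar (k + 1) s \<in> ?rad" if "p \<in> polys ?V" "s \<in> {1..?n}" "s \<noteq> k + 1" for p s
    by (intro mult row that)
  have upper: "xvar (k + 2) i \<in> ?rad" if i: "i \<in> {1..k}" for i
  proof (rule root)
    have "- (xvar (k + 1) (2 * k + 2 - i) * xvar (k + 1) i) - (xvar (k + 2) i)\<^sup>2 \<in> ?rad"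
      using reduced[OF diag[of i]] i unfolding reduced_diagonal_upper[OF i] by simp
    moreover have "xvar (k + 1) (2 * k + 2 - i) * xvar (k + 1) i \<in> ?rad"
      using i by (intro row_mult polys_mvar) auto
    ultimately have "- (xvar (k + 1) (2 * k + 2 - i) * xvar (k + 1) i) - (xvar (k + 2) i)\<^sup>2
        + xvar (k + 1) (2 * k + 2 - i) * xvar (k + 1) i \<in> ?rad"
      by (rule add)
    from diff[OF zero this] show "(xvar (k + 2) i)\<^sup>2 \<in> ?rad" by simp
  qed (use i in auto)
  have lower: "xvar i (k + 1) \<in> ?rad" if i: "i \<in> {k + 3..?n}" for i
  proof (rule root)
    have "(xvar i (k + 1))\<^sup>2 - xvar (k + 1) (2 * k + 2 - i) * xvar (k + 1) i \<in> ?rad"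
      using reduced[OF diag[of i]] i unfolding reduced_diagonal_lower[OF i] by simp
    moreover have "xvar (k + 1) (2 * k + 2 - i) * xvar (k + 1) i \<in> ?rad"
      using i by (intro row_mult polys_mvar) auto
    ultimately have "(xvar i (k + 1))\<^sup>2 - xvar (k + 1) (2 * k + 2 - i) * xvar (k + 1) i
        + xvar (k + 1) (2 * k + 2 - i) * xvar (k + 1) i \<in> ?rad"
      by (rule add)
    then show "(xvar i (k + 1))\<^sup>2 \<in> ?rad" by simp
  qed (use i in auto)
  have middle: "xvar (k + 2) (k + 1) \<in> ?rad"
  proof (rule root)
    let ?s = "\<Sum>l\<in>{1..k}. (xvar (k + 2) l)\<^sup>2 :: (var, 'a) mpoly"
    have "?s + (xvar (k + 2) (k + 1))\<^sup>2 - xvar (k + 1) k * xvar (k + 1) (k + 2) \<in> ?rad"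
      using reduced[OF diag[of "k + 2"]] assms(1) unfolding reduced_diagonal_middle[OF assms(1)] by simp
    moreover have "xvar (k + 1) k * xvar (k + 1) (k + 2) \<in> ?rad"
      using assms(1) by (intro row_mult polys_mvar) auto
    ultimately have "?s + (xvar (k + 2) (k + 1))\<^sup>2 - xvar (k + 1) k * xvar (k + 1) (k + 2)
        + xvar (k + 1) k * xvar (k + 1) (k + 2) \<in> ?rad"
      by (rule add)
    moreover have "?s \<in> ?rad"
      unfolding power2_eq_square by (intro mpoly_ideal_sum[OF rad] mult upper polys_mvar) auto
    ultimately have "?s + (xvar (k + 2) (k + 1))\<^sup>2 - xvar (k + 1) k * xvar (k + 1) (k + 2)
        + xvar (k + 1) k * xvar (k + 1) (k + 2) - ?s \<in> ?rad"
      by (rule diff)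
    then show "(xvar (k + 2) (k + 1))\<^sup>2 \<in> ?rad" by (simp add: algebra_simps)
  qed (use assms(1) in auto)
  have column: "xvar i (k + 1) \<in> ?rad" if "i \<in> {k + 2..?n}" for i
    using that lower[of i] middle by (cases "i = k + 2") auto
  have "reduce_var k v \<in> ?rad"
  proof (cases v)
    case (X i j)
    then show ?thesis
      using v zero row[of j] column[of i] upper[of j] by (auto simp: reduced_x_def)
  next
    case (Y i j)
    then have "2 * k + 2 - i \<in> {1..?n}" and ne: "i \<noteq> k + 1 \<Longrightarrow> 2 * k + 2 - i \<noteq> k + 1"
      using v by auto
    then have "xvar (k + 1) (2 * k + 2 - i) \<in> ?rad" if "i \<noteq> k + 1"
      using row that by blast
    then show ?thesis
      using v Y zero column[of j] upper[of i] by (simp add: reduced_y_def)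
  qed
  moreover have "mvar v - reduce_var k v \<in> ?rad"
    by (intro poly_radical_superset[OF J] reduce_var_congruent[OF J par v])
  ultimately have "mvar v - reduce_var k v + reduce_var k v \<in> ?rad"
    using add by blast
  then show ?thesis by simp
qed

lemma parameters_homogeneous:
  assumes "t \<in> set (parameters k)"
  shows "t \<in> polys (mat_vars (2 * k + 1)) \<and> homogeneous 1 t"
proof -
  show ?thesis
    using assms Lambda_bounds unfolding set_parameters
    by (auto intro!: polys_diff polys_mvar homogeneous_diff simp: homogeneous_mvar[simplified])
qed

section \<open>The system of parameters\<close>

theorem theorem2p1:
  fixes k n :: nat and I :: "(var, 'a::field) mpoly set"
  assumes "k \<ge> 1" and "n = 2 * k + 1"
    and "I = diag_antidiag_ideal n"
  shows "hsop (mat_vars n) I (map (\<lambda>f. I +>\<^bsub>mpoly_ring (mat_vars n)\<^esub> f) (parameters k))"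
proof -
  let ?S = "comm_generators k :: (var, 'a) mpoly set"
  let ?\<theta> = "parameters k :: (var, 'a) mpoly list"
  have I: "I = genideal (mpoly_ring (mat_vars n)) ?S"
    using assms diag_antidiag_ideal_eq by simp
  have S: "?S \<subseteq> polys (mat_vars n)"
    by (auto simp: comm_generators_def assms(2) intro!: comm_entry_polys)
  have \<theta>: "set ?\<theta> \<subseteq> polys (mat_vars n)"
    using parameters_homogeneous assms(2) by blast
  let ?J = "genideal (mpoly_ring (mat_vars n)) (?S \<union> set ?\<theta>)"
  have J: "ideal ?J (mpoly_ring (mat_vars n))" "?S \<union> set ?\<theta> \<subseteq> ?J"
    using S \<theta> by (intro ideal_genideal_mpoly genideal_mpoly_superset; blast)+
  have "I \<subseteq> ?J"
    unfolding I using J by (intro genideal_mpoly_minimal) auto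
  moreover have "{comm_entry n i i | i. i \<in> {1..n}} \<union> {comm_entry n i (n + 1 - i) | i. i \<in> {1..n}} \<subseteq> I"
    unfolding assms(3) diag_antidiag_ideal_def
    by (intro genideal_mpoly_superset) (auto intro!: comm_entry_polys)
  ultimately have entries: "comm_entry n i i \<in> ?J" "comm_entry n i (n + 1 - i) \<in> ?J" if "i \<in> {1..n}" for i
    using that by blast+
  have nil: "\<exists>m. mvar v ^ m \<in> ?J" if "v \<in> mat_vars n" for v
    using variables_in_radical[of k ?J v] assms(1,2) J entries that by (simp add: poly_radical_def)
  show ?thesis
    unfolding I mat_vars_eq
  proof (rule hsopI_linear)
    show "finite (x_vars n)" "finite (y_vars n)" "x_vars n \<inter> y_vars n = {}"
      by (rule finite_x_vars finite_y_vars x_y_vars_disjoint)+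
    show "finite ?S"
      by (simp add: comm_generators_def)
    show "linear_form (x_vars n) (y_vars n) f" if "f \<in> ?S" for f
      using that by (auto simp: comm_generators_def assms(2) intro!: comm_entry_linear)
    show "\<exists>d. homogeneous d f" if "f \<in> ?S" for f
      using that homogeneous_comm_entry by (auto simp: comm_generators_def)
    show "t \<in> polys (x_vars n \<union> y_vars n) \<and> (\<exists>d>0. homogeneous d t)" if "t \<in> set ?\<theta>" for t
      using parameters_homogeneous[OF that] assms(2) by (auto simp: mat_vars_eq)
    show "length ?\<theta> + card ?S \<le> card (x_vars n) + card (y_vars n)"
      using card_comm_generators[where ?'a = 'a, of k] length_parameters[where ?'a = 'a, OF assms(1)]
      by (simp add: card_x_vars card_y_vars assms(2) algebra_simps)
    show "\<exists>m. mvar v ^ m \<in> genideal (mpoly_ring (x_vars n \<union> y_vars n)) (?S \<union> set ?\<theta>)"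
      if "v \<in> x_vars n \<union> y_vars n" for v
      using nil[of v] that by (simp add: mat_vars_eq)
  qed
qed

end
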